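(* For a real number $x>0$ let \[ T(x)=\int_{0}^{+\infty}\left|\left\{\frac{x}{t}\right\}-\left\{\frac{x}{t+1}\right\}\right|\,dt . \] Then, for all $x>0$, \[ T(x)=\frac{2}{\pi}\,\zeta(3/2)\,\sqrt{x}+O\!\left(x^{13/30}\right), \] where $\zeta$ is the Riemann zeta function; that is, there is an absolute constant $C>0$ such that $\left|T(x)-\frac{2}{\pi}\zeta(3/2)\sqrt{x}\right|\le C\,x^{13/30}$ for all $x>0$.
   Context: For a real number $u$, $\{u\}=u-\lfloor u\rfloor$ denotes its fractional part, where $\lfloor u\rfloor$ is the integer part (floor) of $u$. *)

theory Defs
  imports "HOL-Analysis.Analysis"
begin

text \<open>
  The Riemann zeta function on its half-line of absolute convergence \<open>s > 1\<close>, where it is given by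
  its Dirichlet series. For \<open>s \<le> 1\<close> the series diverges and the value is meaningless.
\<close>
definition zeta_real :: "real \<Rightarrow> real" where
  "zeta_real s = (\<Sum>n. 1 / real (Suc n) powr s)"

lemma summable_zeta_real:
  assumes "s > 1"
  shows "summable (\<lambda>n. 1 / real (Suc n) powr s)"
proof -
  have "summable (\<lambda>n. real n powr (-s))"
    using assms by (simp add: summable_real_powr_iff)
  then have "summable (\<lambda>n. real (Suc n) powr (-s))"
    by (subst summable_Suc_iff)
  then show ?thesis
    by (simp only: powr_minus_divide)
qed

definition T :: "real \<Rightarrow> real" where
  "T x = (LBINT t:{0<..}. \<bar>frac (x / t) - frac (x / (t + 1))\<bar>)"

end

theory Submission
  imports Defs "HOL-Probability.Distributions" "HOL-Real_Asymp.Real_Asymp"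
begin

text \<open>
  Put \<open>d = x / (t (t + 1))\<close>, so that \<open>x / (t + 1) = x / t - d\<close>. While \<open>x / t\<close> runs through \<open>[k, k + 1)\<close> the
  gap \<open>d\<close> varies only by \<open>O(k / x)\<close>, hence the integrand averages to \<open>2 {d} (1 - {d})\<close> with an error \<open>O(1 / k)\<close> in
  the integral over the block. Summing over \<open>k \<le> x\<^bsup>2/3\<^esup>\<close>, estimating the rest trivially and replacing \<open>d\<close> by
  \<open>x / t\<^sup>2\<close> costs \<open>O(x\<^bsup>1/3\<^esup>)\<close>. What remains is \<open>sqrt x\<close> times \<open>\<integral> {y} (1 - {y}) y\<^bsup>-3/2\<^esup> dy\<close> over \<open>y > 0\<close>;
  the Laplace transform of \<open>{y} (1 - {y})\<close> is \<open>coth (s / 2) / s\<^sup>2 - 2 / s\<^sup>3\<close>, and the partial fractions of coth turn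
  the integral into \<open>2 / \<pi>\<close> times the series of \<open>\<zeta>(3/2)\<close>.
\<close>

section \<open>Fractional parts\<close>

text \<open>The mean of \<open>\<bar>frac v - frac (v - y)\<bar>\<close> over one period of
  \<open>v\<close>: the value \<open>frac y\<close> is taken on a proportion
  \<open>1 - frac y\<close> of the period, the value \<open>1 - frac y\<close> on the remaining
  proportion \<open>frac y\<close>.\<close>

definition frac_parabola :: "real \<Rightarrow> real" where
  "frac_parabola y = 2 * frac y * (1 - frac y)"

lemma frac_diff:
  fixes v d :: real
  shows "frac (v - d) = (if frac d \<le> frac v then frac v - frac d else frac v - frac d + 1)"
proof -
  have bounds: "0 \<le> frac v \<and> frac v < 1 \<and> 0 \<le> frac d \<and> frac d < 1"
    by (simp add: frac_lt_1)
  have "v - d - (frac v - frac d) = of_int (\<lfloor>v\<rfloor> - \<lfloor>d\<rfloor>)"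
    and "v - d - (frac v - frac d + 1) = of_int (\<lfloor>v\<rfloor> - \<lfloor>d\<rfloor> - 1)"
    by (simp_all add: frac_def)
  then have "v - d - (frac v - frac d) \<in> \<int>" "v - d - (frac v - frac d + 1) \<in> \<int>"
    by (metis Ints_of_int)+
  moreover have "frac d \<le> frac v \<Longrightarrow> 0 \<le> frac v - frac d \<and> frac v - frac d < 1"
    "\<not> frac d \<le> frac v \<Longrightarrow> 0 \<le> frac v - frac d + 1 \<and> frac v - frac d + 1 < 1"
    using bounds by linarith+
  ultimately show ?thesis
    unfolding frac_unique_iff by (simp only: split: if_split) blast
qed

text \<open>For fixed \<open>d\<close> only two values occur, and the switch happens where
  \<open>frac v\<close> passes \<open>frac d\<close>. This makes the integral over a block with
  frozen gap explicit.\<close>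

lemma abs_frac_diff_shift:
  fixes v d :: real
  shows "\<bar>frac v - frac (v - d)\<bar> = (if frac d \<le> frac v then frac d else 1 - frac d)"
  using frac_lt_1[of d] by (simp add: frac_diff)

lemma frac_le_self: "0 \<le> y \<Longrightarrow> frac y \<le> (y::real)"
  by (simp add: frac_def)

lemma frac_parabola_nonneg: "0 \<le> frac_parabola y"
  using frac_ge_0[of y] frac_lt_1[of y] by (simp add: frac_parabola_def)

lemma frac_parabola_le_frac: "frac_parabola y \<le> 2 * frac y"
  using frac_ge_0[of y] mult_left_le[of "1 - frac y" "2 * frac y"]
  by (simp add: frac_parabola_def)

lemma frac_parabola_le_one_minus_frac: "frac_parabola y \<le> 2 * (1 - frac y)"
  using frac_lt_1[of y] mult_left_le[of "frac y" "2 * (1 - frac y)"]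
  by (simp add: frac_parabola_def algebra_simps)

lemma frac_parabola_le_1: "frac_parabola y \<le> 1"
  using frac_parabola_le_frac[of y] frac_parabola_le_one_minus_frac[of y] by argo

lemma frac_parabola_measurable [measurable]: "frac_parabola \<in> borel_measurable borel"
  unfolding frac_parabola_def frac_def by measurable

text \<open>Between consecutive integers the function is a quadratic of slope at most 2 in absolute
  value. Across an integer, both values are at most twice the distance to that integer. Steps of
  length at least 1 are covered by the range \<open>[0, 1]\<close>.\<close>

lemma frac_parabola_lipschitz: "\<bar>frac_parabola a - frac_parabola b\<bar> \<le> 2 * \<bar>a - b\<bar>"
proof -
  have *: "\<bar>frac_parabola a - frac_parabola b\<bar> \<le> 2 * (b - a)" if ab: "a \<le> b" for a b
  proof (cases "b - a < 1")
    case False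
    then show ?thesis using frac_parabola_nonneg[of a] frac_parabola_nonneg[of b]
        frac_parabola_le_1[of a] frac_parabola_le_1[of b] by argo
  next
    case lt: True
    show ?thesis
    proof (cases "\<lfloor>a\<rfloor> = \<lfloor>b\<rfloor>")
      case True
      then have b: "frac b = frac a + (b - a)" by (simp add: frac_def)
      have "frac_parabola a - frac_parabola b = 2 * ((b - a) * (frac a + frac b - 1))"
        unfolding frac_parabola_def b by (simp add: algebra_simps)
      moreover have "\<bar>(b - a) * (frac a + frac b - 1)\<bar> \<le> (b - a) * 1"
        unfolding abs_mult
        using ab frac_ge_0[of a] frac_ge_0[of b] frac_lt_1[of a] frac_lt_1[of b]
        by (intro mult_mono) (simp, linarith, simp_all)
      ultimately show ?thesis by simp
    next
      case False
      have "\<lfloor>b\<rfloor> = \<lfloor>a\<rfloor> + 1" using False lt ab by linarith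
      then have "(1 - frac a) + frac b = b - a" by (simp add: frac_def)
      moreover have "0 \<le> frac b" "0 \<le> 1 - frac a" using frac_lt_1[of a] frac_ge_0[of b] by auto
      ultimately show ?thesis
        using frac_parabola_le_frac[of b] frac_parabola_le_one_minus_frac[of a]
          frac_parabola_nonneg[of a] frac_parabola_nonneg[of b] by argo
    qed
  qed
  show ?thesis using *[of a b] *[of b a] by (cases "a \<le> b") auto
qed

lemma abs_frac_diff_le:
  fixes a b :: real
  assumes "a \<le> b"
  shows "\<bar>frac b - frac a\<bar> \<le> (b - a) + (if frac b < b - a then 1 else 0)"
proof (cases "\<lfloor>a\<rfloor> = \<lfloor>b\<rfloor>")
  case True
  then show ?thesis using assms by (simp add: frac_def)
next
  case False
  then have "\<lfloor>a\<rfloor> + 1 \<le> \<lfloor>b\<rfloor>" using floor_mono[OF assms] by linarith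
  then have "a < of_int \<lfloor>b\<rfloor>" by linarith
  then have "frac b < b - a" by (simp add: frac_def)
  moreover have "\<bar>frac b - frac a\<bar> \<le> 1"
    using frac_ge_0[of a] frac_ge_0[of b] frac_lt_1[of a] frac_lt_1[of b] by linarith
  ultimately show ?thesis using assms by simp
qed

section \<open>Averaging over one period of \<open>x / t\<close>\<close>

definition gap :: "real \<Rightarrow> real \<Rightarrow> real" where
  "gap x t = x / (t * (t + 1))"

lemma diff_eq_gap: "t > 0 \<Longrightarrow> x / (t + 1) = x / t - gap x t"
  unfolding gap_def by (simp add: divide_simps) (simp add: algebra_simps)

lemma gap_antimono:
  assumes "x > 0" "0 < s" "s \<le> t"
  shows "gap x t \<le> gap x s"
  unfolding gap_def using assms by (intro divide_left_mono mult_mono) (auto intro!: mult_pos_pos)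

lemma gap_at_quotient: "x > 0 \<Longrightarrow> u > 0 \<Longrightarrow> gap x (x / u) = u\<^sup>2 / (x + u)"
  unfolding gap_def by (simp add: divide_simps add_pos_pos power2_eq_square)

text \<open>The gap decreases in \<open>t\<close>, so on the block it lies between its end values
  \<open>k^2 / (x + k)\<close> and \<open>(k + 1)^2 / (x + k + 1)\<close>. The numerators differ by
  \<open>2 * k + 1\<close>, which is at most \<open>3 * k\<close>.\<close>

lemma gap_oscillation:
  assumes x: "x > 0" and k: "k \<ge> (1::real)" and t: "x / (k + 1) < t" "t \<le> x / k"
  shows "gap x (x / k) \<le> gap x t" "gap x t \<le> gap x (x / k) + 3 * k / x"
proof -
  have pos: "x / (k + 1) > 0" using x k by simp
  show "gap x (x / k) \<le> gap x t" using x pos t by (intro gap_antimono) auto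
  have "gap x t \<le> gap x (x / (k + 1))" using x pos t by (intro gap_antimono) auto
  also have "\<dots> = (k + 1)\<^sup>2 / (x + (k + 1))" using x k by (intro gap_at_quotient) auto
  also have "\<dots> \<le> (k + 1)\<^sup>2 / (x + k)" using x k by (intro divide_left_mono) auto
  also have "\<dots> = k\<^sup>2 / (x + k) + (2 * k + 1) / (x + k)"
    by (simp add: add_divide_distrib[symmetric] power2_eq_square algebra_simps)
  also have "(2 * k + 1) / (x + k) \<le> 3 * k / x"
    using x k by (intro frac_le) auto
  also have "k\<^sup>2 / (x + k) = gap x (x / k)" using x k by (simp add: gap_at_quotient)
  finally show "gap x t \<le> gap x (x / k) + 3 * k / x" by simp
qed

definition osc :: "real \<Rightarrow> real \<Rightarrow> real" where
  "osc x t = \<bar>frac (x / t) - frac (x / (t + 1))\<bar>"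

lemma frac_measurable [measurable]: "(frac :: real \<Rightarrow> real) \<in> borel_measurable borel"
  unfolding frac_def by measurable

lemma osc_measurable [measurable]: "osc x \<in> borel_measurable borel"
  unfolding osc_def by measurable

lemma gap_measurable [measurable]: "gap x \<in> borel_measurable borel"
  unfolding gap_def by measurable

text \<open>Converts lengths in \<open>x / t\<close> into lengths in \<open>t\<close>: this is the
  interval on which \<open>x / t\<close> runs from \<open>a\<close> to \<open>a + e\<close>.\<close>

lemma quotient_diff_le:
  assumes "x > 0" "k > (0::real)" "k \<le> a" "0 \<le> e"
  shows "0 \<le> x / a - x / (a + e)" "x / a - x / (a + e) \<le> x * e / k\<^sup>2"
proof -
  have eq: "x / a - x / (a + e) = x * e / (a * (a + e))"
    using assms by (simp add: field_simps)
  show "0 \<le> x / a - x / (a + e)" unfolding eq using assms by auto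
  show "x / a - x / (a + e) \<le> x * e / k\<^sup>2"
    unfolding eq power2_eq_square using assms by (intro divide_left_mono mult_mono) (auto intro!: mult_pos_pos)
qed

lemma frac_block:
  assumes x: "x > 0" and n: "n \<ge> (1::nat)" and t: "x / (real n + 1) < t" "t \<le> x / real n"
  shows "frac (x / t) = x / t - real n" "t > 0"
proof -
  have "0 < x / (real n + 1)" using x by simp
  then show "t > 0" using t by linarith
  then have "real n \<le> x / t" "x / t < real n + 1"
    using t n by (simp_all add: field_simps)
  then have "\<lfloor>x / t\<rfloor> = int n" by (intro floor_unique) auto
  then show "frac (x / t) = x / t - real n" by (simp add: frac_def)
qed

lemma integrable_indicator_Ioc [simp]: "integrable lborel (indicator {a<..b::real} :: real \<Rightarrow> real)"
  by (cases "a \<le> b") (auto intro!: integrable_real_indicator)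

text \<open>With constant \<open>d\<close> the integrand is a step function with a single jump at
  \<open>x / (k + \<theta>)\<close>. Since \<open>frac_parabola d\<close> is the mean with respect
  to \<open>x / t\<close>, only the non-uniformity of \<open>dt\<close> over the block survives. The
  factor \<open>frac d\<close> is kept in the bound because it can be much smaller than 1.\<close>

lemma integral_frozen_block:
  fixes d :: real
  assumes x: "x > 0" and n: "n \<ge> (1::nat)"
  shows "integrable lborel (\<lambda>t. indicator {x / (real n + 1)<..x / real n} t *
          (\<bar>frac (x / t) - frac (x / t - d)\<bar> - frac_parabola d))"
    and "\<bar>LBINT t. indicator {x / (real n + 1)<..x / real n} t *
          (\<bar>frac (x / t) - frac (x / t - d)\<bar> - frac_parabola d)\<bar> \<le> x * frac d / real n ^ 3"
proof -
  define k \<theta> where "k = real n" and "\<theta> = frac d"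
  have k: "k \<ge> 1" using n by (simp add: k_def)
  have \<theta>: "0 \<le> \<theta>" "\<theta> < 1" by (simp_all add: \<theta>_def frac_lt_1)
  have ord: "x / (k + 1) \<le> x / (k + \<theta>)" "x / (k + \<theta>) \<le> x / k"
    using x k \<theta> by (auto intro!: divide_left_mono)
  let ?f = "\<lambda>t. indicator {x / (k + 1)<..x / k} t * (\<bar>frac (x / t) - frac (x / t - d)\<bar> - frac_parabola d)"
  let ?g = "\<lambda>t. (\<theta> - frac_parabola d) * indicator {x / (k + 1)<..x / (k + \<theta>)} t
                + (1 - \<theta> - frac_parabola d) * indicator {x / (k + \<theta>)<..x / k} t"
  have eq: "?f = ?g"
  proof
    fix t
    show "?f t = ?g t"
    proof (cases "x / (k + 1) < t \<and> t \<le> x / k")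
      case True
      then have w: "frac (x / t) = x / t - k" "t > 0"
        using frac_block[OF x n, of t] by (auto simp: k_def)
      have "frac d \<le> frac (x / t) \<longleftrightarrow> t \<le> x / (k + \<theta>)"
        unfolding w(1) using w(2) k \<theta> by (simp add: \<theta>_def[symmetric] field_simps)
      then show ?thesis using True ord unfolding abs_frac_diff_shift
        by (auto simp: indicator_def \<theta>_def)
    next
      case False
      then show ?thesis using ord by (auto simp: indicator_def)
    qed
  qed
  have int: "integrable lborel (\<lambda>t. c * indicator {a<..b} t :: real)" for a b c :: real
    by (intro integrable_mult_right integrable_indicator_Ioc)
  show "integrable lborel (\<lambda>t. indicator {x / (real n + 1)<..x / real n} t *
          (\<bar>frac (x / t) - frac (x / t - d)\<bar> - frac_parabola d))"
    unfolding k_def[symmetric] eq by (intro Bochner_Integration.integrable_add int)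
  have "(LBINT t. ?f t) = (\<theta> - frac_parabola d) * (x / (k + \<theta>) - x / (k + 1))
                + (1 - \<theta> - frac_parabola d) * (x / k - x / (k + \<theta>))"
    unfolding eq using ord by (subst Bochner_Integration.integral_add) (auto intro!: int)
  \<comment> \<open>The step heights are \<open>\<theta> * (2 * \<theta> - 1)\<close> and
    \<open>(1 - \<theta>) * (1 - 2 * \<theta>)\<close>. The lengths carry the factors
    \<open>(1 - \<theta>) * k\<close> and \<open>\<theta> * (k + 1)\<close>, so everything cancels
    except the difference of \<open>k + 1\<close> and \<open>k\<close>.\<close>
  also have "\<dots> = x * \<theta> * (1 - \<theta>) * (1 - 2 * \<theta>) / (k * (k + 1) * (k + \<theta>))"
  proof -
    have fp: "frac_parabola d = 2 * \<theta> * (1 - \<theta>)" by (simp add: frac_parabola_def \<theta>_def)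
    have nz: "k \<noteq> 0" "k + 1 \<noteq> 0" "k + \<theta> \<noteq> 0" using k \<theta> by auto
    have a: "x / (k + \<theta>) - x / (k + 1) = x * (1 - \<theta>) * k / (k * (k + 1) * (k + \<theta>))"
      using nz by (simp add: divide_simps) algebra
    have b: "x / k - x / (k + \<theta>) = x * \<theta> * (k + 1) / (k * (k + 1) * (k + \<theta>))"
      using nz by (simp add: divide_simps) algebra
    show ?thesis unfolding fp a b times_divide_eq_right add_divide_distrib[symmetric]
      by (rule arg_cong[where f = "\<lambda>z. z / _"]) algebra
  qed
  also have "\<bar>\<dots>\<bar> \<le> x * \<theta> / (k * k * k)"
  proof -
    have "\<bar>x * \<theta> * (1 - \<theta>) * (1 - 2 * \<theta>)\<bar> = (x * \<theta>) * ((1 - \<theta>) * \<bar>1 - 2 * \<theta>\<bar>)"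
      using x \<theta> by (simp add: abs_mult)
    also have "\<dots> \<le> (x * \<theta>) * (1 * 1)"
      using x \<theta> by (intro mult_left_mono mult_mono) auto
    finally have num: "\<bar>x * \<theta> * (1 - \<theta>) * (1 - 2 * \<theta>)\<bar> \<le> x * \<theta>" by simp
    have den: "\<bar>k * (k + 1) * (k + \<theta>)\<bar> \<ge> k * k * k"
      using k \<theta> by (simp add: abs_mult) (intro mult_mono; simp)
    show ?thesis unfolding abs_divide using num den x k \<theta> by (intro frac_le) auto
  qed
  finally show "\<bar>LBINT t. indicator {x / (real n + 1)<..x / real n} t *
          (\<bar>frac (x / t) - frac (x / t - d)\<bar> - frac_parabola d)\<bar> \<le> x * frac d / real n ^ 3"
    by (simp add: k_def \<theta>_def power3_eq_cube)
qed

text \<open>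
  The gap is replaced by its value \<open>d\<close> at the right end of the block; it varies by at most \<open>\<eta> = 3 k / x\<close>.
  Outside \<open>B1 \<union> B2\<close> no integer lies between the true and the frozen value of \<open>x / (t + 1)\<close>, so there the
  integrand changes by \<open>O(\<eta>)\<close> only; both error sets have length \<open>O(x \<eta> / k\<^sup>2) = O(1 / k)\<close>.
\<close>

lemma integral_block:
  assumes x: "x > 0" and n: "n \<ge> (1::nat)"
  shows "\<bar>LBINT t:{x / (real n + 1)<..x / real n}. osc x t - frac_parabola (gap x t)\<bar> \<le> 16 / real n"
proof -
  define k d \<eta> I where "k = real n" and "d = gap x (x / k)" and "\<eta> = 3 * k / x"
    and "I = {x / (k + 1)<..x / k}"
  define \<theta> where "\<theta> = frac d"
  have k: "k \<ge> 1" using n by (simp add: k_def)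
  have \<theta>: "0 \<le> \<theta>" "\<theta> < 1" by (simp_all add: \<theta>_def frac_lt_1)
  have \<eta>: "\<eta> > 0" using x k by (simp add: \<eta>_def)
  define G where "G t = \<bar>frac (x / t) - frac (x / t - d)\<bar> - frac_parabola d" for t
  define R where "R t = osc x t - frac_parabola (gap x t) - G t" for t
  define B1 B2 where "B1 = {x / (k + \<theta> + \<eta>)<..x / (k + \<theta>)}" and "B2 = {x / (k + \<eta>)<..x / k}"
  \<comment> \<open>Of the factor 3, one \<open>\<eta>\<close> pays for moving
    \<open>x / (t + 1)\<close> and two for the Lipschitz bound on
    \<open>frac_parabola\<close>.\<close>
  define r where "r t = 3 * \<eta> * indicator I t + indicator B1 t + indicator B2 t" for t
  have G_meas [measurable]: "G \<in> borel_measurable borel" unfolding G_def by measurable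
  have R_meas [measurable]: "R \<in> borel_measurable borel" unfolding R_def by measurable
  have int_r: "integrable lborel r"
    unfolding r_def I_def B1_def B2_def
    by (intro Bochner_Integration.integrable_add integrable_mult_right integrable_indicator_Ioc)
  have bound: "\<bar>indicator I t * R t\<bar> \<le> r t" for t
  proof (cases "t \<in> I")
    case False
    then show ?thesis using \<eta> by (simp add: r_def)
  next
    case True
    then have t: "x / (k + 1) < t" "t \<le> x / k" by (auto simp: I_def)
    have w: "frac (x / t) = x / t - k" "t > 0"
      using frac_block[OF x n, of t] t by (auto simp: k_def)
    note osc = gap_oscillation[OF x k t, folded d_def \<eta>_def]
    have "\<bar>osc x t - \<bar>frac (x / t) - frac (x / t - d)\<bar>\<bar> \<le> \<bar>frac (x / t - d) - frac (x / t - gap x t)\<bar>"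
      unfolding osc_def diff_eq_gap[OF w(2)] by linarith
    also have "\<dots> \<le> (gap x t - d) + (if frac (x / t - d) < gap x t - d then 1 else 0)"
      using abs_frac_diff_le[of "x / t - gap x t" "x / t - d"] osc by simp
    also have "\<dots> \<le> \<eta> + (if frac (x / t - d) < \<eta> then 1 else 0)" using osc by auto
    also have "(if frac (x / t - d) < \<eta> then 1 else 0) \<le> (indicator B1 t + indicator B2 t :: real)"
    proof (cases "frac (x / t - d) < \<eta>")
      case less: True
      have "t \<in> B1 \<or> t \<in> B2"
      proof (cases "\<theta> \<le> frac (x / t)")
        case True
        then have "\<theta> \<le> x / t - k" "x / t - k - \<theta> < \<eta>"
          using less by (simp_all add: frac_diff w(1) \<theta>_def)
        then have "t \<in> B1" using w(2) k \<theta> \<eta> by (auto simp: B1_def field_simps)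
        then show ?thesis ..
      next
        case False
        \<comment> \<open>Wrap-around case: the fractional part is
          \<open>x / t - k - \<theta> + 1\<close>, so
          \<open>x / t - k < \<eta> + \<theta> - 1\<close>, and \<open>\<theta> < 1\<close> leaves
          \<open>\<eta>\<close>.\<close>
        then have "x / t - k < \<eta>"
          using less \<theta> by (simp add: frac_diff w(1) \<theta>_def)
        then have "t \<in> B2" using w(2) k \<eta> t(2) by (auto simp: B2_def field_simps)
        then show ?thesis ..
      qed
      then show ?thesis using less by (auto simp: indicator_def)
    qed (auto simp: indicator_def)
    finally have 1: "\<bar>osc x t - \<bar>frac (x / t) - frac (x / t - d)\<bar>\<bar> \<le> \<eta> + (indicator B1 t + indicator B2 t)"
      by simp
    have 2: "\<bar>frac_parabola (gap x t) - frac_parabola d\<bar> \<le> 2 * \<eta>"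
      using frac_parabola_lipschitz[of "gap x t" d] osc by simp
    show ?thesis using True 1 2 by (simp add: R_def G_def r_def)
  qed
  have int_R: "integrable lborel (\<lambda>t. indicator I t * R t)"
    by (rule Bochner_Integration.integrable_bound[OF int_r]) (use bound in \<open>auto simp: I_def intro: order_trans[OF _ abs_ge_self]\<close>)
  have len: "0 \<le> x / k - x / (k + 1)" "x / k - x / (k + 1) \<le> x / k\<^sup>2"
    using quotient_diff_le[of x k k 1] x k by auto
  have len1: "0 \<le> x / (k + \<theta>) - x / (k + \<theta> + \<eta>)" "x / (k + \<theta>) - x / (k + \<theta> + \<eta>) \<le> x * \<eta> / k\<^sup>2"
    using quotient_diff_le[of x k "k + \<theta>" \<eta>] x k \<theta> \<eta> by auto
  have len2: "0 \<le> x / k - x / (k + \<eta>)" "x / k - x / (k + \<eta>) \<le> x * \<eta> / k\<^sup>2"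
    using quotient_diff_le[of x k k \<eta>] x k \<theta> \<eta> by auto
  have e: "x * \<eta> / k\<^sup>2 = 3 / k" using x k by (simp add: \<eta>_def power2_eq_square)
  have "\<bar>LBINT t. indicator I t * R t\<bar> \<le> (LBINT t. r t)"
    using int_R int_r bound by (intro integral_abs_bound_integral) auto
  also have "\<dots> = 3 * \<eta> * (x / k - x / (k + 1)) + (x / (k + \<theta>) - x / (k + \<theta> + \<eta>)) + (x / k - x / (k + \<eta>))"
    unfolding r_def I_def B1_def B2_def using len(1) len1(1) len2(1)
    by (simp add: Bochner_Integration.integral_add Bochner_Integration.integrable_add)
  \<comment> \<open>All terms are multiples of \<open>x * \<eta> / k^2 = 3 / k\<close>: three from
    the block, whose length is at most \<open>x / k^2\<close>, and one from each exceptional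
    set.\<close>
  also have "\<dots> \<le> 3 * \<eta> * (x / k\<^sup>2) + x * \<eta> / k\<^sup>2 + x * \<eta> / k\<^sup>2"
    using len len1 len2 \<eta> by (intro add_mono mult_left_mono) auto
  also have "\<dots> = 5 * (x * \<eta> / k\<^sup>2)" by simp
  also have "\<dots> = 15 / k" unfolding e by simp
  finally have 1: "\<bar>LBINT t. indicator I t * R t\<bar> \<le> 15 / k" .
  have "\<theta> \<le> d" unfolding \<theta>_def d_def using x k by (intro frac_le_self) (simp add: gap_def)
  also have "d \<le> k\<^sup>2 / x" unfolding d_def using x k by (simp add: gap_at_quotient frac_le)
  finally have "x * \<theta> / k ^ 3 \<le> x * (k\<^sup>2 / x) / k ^ 3"
    using x k by (intro divide_right_mono mult_left_mono) auto
  also have "\<dots> = 1 / k" using x k by (simp add: power2_eq_square power3_eq_cube)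
  finally have 2: "\<bar>LBINT t. indicator I t * G t\<bar> \<le> 1 / k"
    using integral_frozen_block(2)[OF x n, of d] by (simp add: G_def I_def k_def \<theta>_def)
  have "(LBINT t:{x / (real n + 1)<..x / real n}. osc x t - frac_parabola (gap x t))
      = (LBINT t. indicator I t * R t + indicator I t * G t)"
    unfolding set_lebesgue_integral_def I_def k_def R_def
    by (intro Bochner_Integration.integral_cong) (auto simp: algebra_simps)
  also have "\<dots> = (LBINT t. indicator I t * R t) + (LBINT t. indicator I t * G t)"
    using int_R integral_frozen_block(1)[OF x n, of d]
    by (intro Bochner_Integration.integral_add) (auto simp: G_def I_def k_def)
  finally show ?thesis using 1 2 by (simp add: k_def)
qed


section \<open>Integrals over the half-line of bounded functions with power decay\<close>

lemma has_bochner_integral_inverse_power_tail: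
  assumes a: "a > 0" and m: "m > 0"
  shows "has_bochner_integral lborel (\<lambda>t::real. indicator {a..} t * (1 / t ^ Suc m)) (1 / (real m * a ^ m))"
proof (rule has_bochner_integral_nn_integral)
  have "(\<integral>\<^sup>+t. ennreal (1 / t ^ Suc m) * indicator {a..} t \<partial>lborel)
      = ennreal (0 - (- (1 / (real m * a ^ m))))"
  proof (rule nn_integral_FTC_atLeast)
    fix t :: real assume "a \<le> t"
    then have t: "t > 0" using a by simp
    have "((\<lambda>t. - (1 / (real m * t ^ m))) has_real_derivative
        (real m * (real m * t ^ (m - 1))) / ((real m * t ^ m) * (real m * t ^ m))) (at t)"
      using t m by (auto intro!: derivative_eq_intros simp: field_simps)
    also have "(real m * (real m * t ^ (m - 1))) / ((real m * t ^ m) * (real m * t ^ m)) = 1 / t ^ Suc m"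
    proof -
      obtain l where l: "m = Suc l" using m by (cases m) auto
      have "real m \<noteq> 0" "t ^ l \<noteq> 0" "t \<noteq> 0" using m t by auto
      then show ?thesis unfolding l by (simp add: divide_simps del: of_nat_Suc)
    qed
    finally show "DERIV (\<lambda>t. - (1 / (real m * t ^ m))) t :> 1 / t ^ Suc m" .
    show "0 \<le> 1 / t ^ Suc m" using t by simp
  next
    have "filterlim (\<lambda>t::real. real m * t ^ m) at_top at_top"
      using m by (intro filterlim_tendsto_pos_mult_at_top[OF tendsto_const] filterlim_pow_at_top filterlim_ident) auto
    then have "((\<lambda>t::real. - inverse (real m * t ^ m)) \<longlongrightarrow> - 0) at_top"
      by (intro tendsto_minus tendsto_inverse_0_at_top)
    then show "((\<lambda>t::real. - (1 / (real m * t ^ m))) \<longlongrightarrow> 0) at_top"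
      by (simp add: inverse_eq_divide)
  qed measurable
  also have "(\<integral>\<^sup>+t. ennreal (1 / t ^ Suc m) * indicator {a..} t \<partial>lborel)
      = (\<integral>\<^sup>+t. ennreal (indicator {a..} t * (1 / t ^ Suc m)) \<partial>lborel)"
    by (intro nn_integral_cong) (auto simp: indicator_def)
  finally show "(\<integral>\<^sup>+t. ennreal (indicator {a..} t * (1 / t ^ Suc m)) \<partial>lborel) = ennreal (1 / (real m * a ^ m))"
    by simp
qed (use a m in \<open>auto simp: indicator_def\<close>)

text \<open>Serves both for integrability on \<open>{0<..}\<close> and for error bounds. With
  \<open>c = 0\<close> or \<open>M = 0\<close> it also handles functions cut off to one side of
  \<open>a\<close>.\<close>

lemma integral_bounded_decay:
  fixes f :: "real \<Rightarrow> real"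
  assumes f [measurable]: "f \<in> borel_measurable borel" and a: "a > 0" and m: "m > 0"
    and near: "\<And>t. 0 < t \<Longrightarrow> t \<le> a \<Longrightarrow> \<bar>f t\<bar> \<le> M" and far: "\<And>t. a < t \<Longrightarrow> \<bar>f t\<bar> \<le> c / t ^ Suc m"
  shows "set_integrable lborel {0<..} f"
    and "\<bar>LBINT t:{0<..}. f t\<bar> \<le> M * a + c / (real m * a ^ m)"
proof -
  define r where "r t = M * indicator {0<..a} t + c * (indicator {a..} t * (1 / t ^ Suc m))" for t
  note tail = has_bochner_integral_inverse_power_tail[OF a m]
  \<comment> \<open>The sign of \<open>c\<close> is read off from the decay hypothesis at the single
    point \<open>a + 1\<close>.\<close>
  have "0 \<le> c / (a + 1) ^ Suc m" using far[of "a + 1"] abs_ge_zero[of "f (a + 1)"] by linarith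
  moreover have "(a + 1) ^ Suc m > 0" using a by (intro zero_less_power) simp
  ultimately have c: "c \<ge> 0" using divide_neg_pos[of c "(a + 1) ^ Suc m"] by linarith
  have r: "has_bochner_integral lborel r (M * a + c * (1 / (real m * a ^ m)))"
  proof -
    have "has_bochner_integral lborel (indicator {0<..a} :: real \<Rightarrow> real) a"
      using a by (simp add: has_bochner_integral_iff)
    then show ?thesis unfolding r_def
      by (intro has_bochner_integral_add has_bochner_integral_mult_right tail)
  qed
  have bound: "\<bar>indicator {0<..} t * f t\<bar> \<le> r t" for t
    using near[of t] far[of t] a c by (cases "t \<le> a") (auto simp: r_def indicator_def intro!: add_increasing2)
  have int: "integrable lborel (\<lambda>t. indicator {0<..} t * f t)"
    by (rule Bochner_Integration.integrable_bound[OF integrable.intros[OF r]])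
       (use bound in \<open>auto intro: order_trans[OF _ abs_ge_self]\<close>)
  then show "set_integrable lborel {0<..} f" by (simp add: set_integrable_def)
  have "\<bar>LBINT t. indicator {0<..} t * f t\<bar> \<le> (LBINT t. r t)"
    using int r bound by (intro integral_abs_bound_integral) (auto simp: has_bochner_integral_iff)
  then show "\<bar>LBINT t:{0<..}. f t\<bar> \<le> M * a + c / (real m * a ^ m)"
    using has_bochner_integral_integral_eq[OF r] by (simp add: set_lebesgue_integral_def)
qed

section \<open>Reduction to the averaged integrand\<close>

text \<open>Adds the block errors \<open>16 / k\<close>. The square root telescopes easily and is
  good enough in place of a logarithm: with about \<open>x powr (2 / 3)\<close> blocks it has order
  \<open>x powr (1 / 3)\<close>.\<close>

lemma integral_middle_blocks:
  assumes x: "x > 0" and int: "set_integrable lborel {0<..} (\<lambda>t. osc x t - frac_parabola (gap x t))"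
  shows "\<bar>LBINT t:{x / (real n + 1)<..x}. osc x t - frac_parabola (gap x t)\<bar> \<le> 32 * sqrt (real n)"
proof (induction n)
  case 0
  then show ?case by (simp add: set_lebesgue_integral_def)
next
  case (Suc n)
  let ?f = "\<lambda>t. osc x t - frac_parabola (gap x t)"
  let ?I = "{x / (real (Suc n) + 1)<..x / real (Suc n)}" and ?J = "{x / (real n + 1)<..x}"
  have ord: "0 < x / (real (Suc n) + 1)" "x / (real (Suc n) + 1) \<le> x / real (Suc n)" "x / real (Suc n) \<le> x"
    using x by (auto intro!: divide_left_mono simp: field_simps)
  have "{x / (real (Suc n) + 1)<..x} = ?I \<union> ?J"
    using ord by (auto simp: add.commute)
  then have "(LBINT t:{x / (real (Suc n) + 1)<..x}. ?f t) = (LBINT t:?I. ?f t) + (LBINT t:?J. ?f t)"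
    using ord
    by (simp only:) (intro set_integral_Un set_integrable_subset[OF int]; auto simp: add.commute)
  moreover have "\<bar>LBINT t:?I. ?f t\<bar> \<le> 16 / real (Suc n)"
    using x by (intro integral_block) auto
  \<comment> \<open>Telescoping step \<open>1 / q^2 \<le> 2 * (q - p)\<close>, from
    \<open>q^2 - p^2 = 1\<close>, \<open>p \<le> q\<close> and \<open>q \<ge> 1\<close>.\<close>
  moreover have "16 / real (Suc n) + 32 * sqrt (real n) \<le> 32 * sqrt (real (Suc n))"
  proof -
    define p q where "p = sqrt (real n)" and "q = sqrt (real (Suc n))"
    have q: "q * q = real (Suc n)" "q \<ge> 1" and p: "p * p = real n" "p \<ge> 0" "p \<le> q"
      by (simp_all add: p_def q_def)
    have "1 = (q - p) * (q + p)" using p q by (simp add: algebra_simps)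
    also have "\<dots> \<le> (q - p) * (2 * q)" using p by (intro mult_left_mono) auto
    also have "\<dots> \<le> (q - p) * (2 * (q * q))"
      using p q(2) mult_left_mono[of 1 q q] by (intro mult_left_mono) auto
    finally have "1 / real (Suc n) \<le> 2 * (q - p)"
      using q by (subst pos_divide_le_eq) (auto simp: algebra_simps)
    then show ?thesis by (simp add: p_def q_def)
  qed
  ultimately show ?case using Suc.IH by linarith
qed

lemma osc_bounds: "0 \<le> osc x t" "osc x t \<le> 1"
  using frac_ge_0[of "x / t"] frac_lt_1[of "x / t"] frac_ge_0[of "x / (t + 1)"] frac_lt_1[of "x / (t + 1)"]
  unfolding osc_def by linarith+

lemma gap_bounds:
  assumes "x > 0" "t > 0"
  shows "0 \<le> gap x t" "gap x t \<le> x / t\<^sup>2"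
  unfolding gap_def power2_eq_square using assms by (auto intro!: divide_left_mono mult_pos_pos)

text \<open>Beyond \<open>x\<close> both quotients lie in \<open>[0, 1)\<close>, so they equal their
  fractional parts and the integrand is the gap itself.\<close>

lemma osc_tail:
  assumes "x > 0" "t > x"
  shows "osc x t \<le> x / t\<^sup>2"
proof -
  have "frac (x / t) = x / t" "frac (x / (t + 1)) = x / (t + 1)"
    using assms by (auto simp: frac_eq)
  then have "osc x t = gap x t"
    using assms gap_bounds[of x t] by (simp add: osc_def diff_eq_gap)
  then show ?thesis using assms gap_bounds[of x t] by simp
qed

lemma frac_parabola_le_twice: "0 \<le> y \<Longrightarrow> frac_parabola y \<le> 2 * y"
  using frac_parabola_le_frac[of y] frac_le_self[of y] by linarith

lemma set_integrable_osc: "x > 0 \<Longrightarrow> set_integrable lborel {0<..} (osc x)"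
  by (rule integral_bounded_decay(1)[where a = x and m = 1 and M = 1 and c = x])
     (use osc_bounds[of x] osc_tail[of x] in \<open>auto simp: power2_eq_square\<close>)

lemma set_integrable_frac_parabola_gap:
  "x > 0 \<Longrightarrow> set_integrable lborel {0<..} (\<lambda>t. frac_parabola (gap x t))"
proof (rule integral_bounded_decay(1)[where a = 1 and m = 1 and M = 1 and c = "2 * x"])
  fix t :: real assume "x > 0" "1 < t"
  then show "\<bar>frac_parabola (gap x t)\<bar> \<le> 2 * x / t ^ Suc 1"
    using frac_parabola_le_twice[of "gap x t"] gap_bounds[of x t] frac_parabola_nonneg[of "gap x t"]
    by (simp add: power2_eq_square)
qed (auto simp: frac_parabola_nonneg frac_parabola_le_1)

text \<open>Splits the half-line at \<open>x / (n + 1)\<close> and \<open>x\<close>: the trivial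
  bound 1 on the left, \<open>n\<close> averaged blocks in the middle, quadratic decay on the
  right.\<close>

lemma integral_osc_minus_parabola:
  assumes x: "x > 0"
  shows "\<bar>LBINT t:{0<..}. osc x t - frac_parabola (gap x t)\<bar> \<le> x / (real n + 1) + 32 * sqrt (real n) + 2"
proof -
  let ?f = "\<lambda>t. osc x t - frac_parabola (gap x t)"
  let ?b = "x / (real n + 1)"
  have int: "set_integrable lborel {0<..} ?f"
    using set_integral_diff(1)[OF set_integrable_osc[OF x] set_integrable_frac_parabola_gap[OF x]] .
  have b: "0 < ?b" "?b \<le> x" using x by (auto simp: field_simps)
  have f1: "\<bar>?f t\<bar> \<le> 1" for t
    using osc_bounds[of x t] frac_parabola_nonneg[of "gap x t"] frac_parabola_le_1[of "gap x t"] by linarith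
  \<comment> \<open>Both functions are nonnegative, so the larger of the bounds
    \<open>x / t^2\<close> and \<open>2 * x / t^2\<close> suffices instead of their sum.\<close>
  have f2: "\<bar>?f t\<bar> \<le> 2 * x / t ^ Suc 1" if "t > x" for t
    using osc_bounds[of x t] osc_tail[OF x that] frac_parabola_nonneg[of "gap x t"]
      frac_parabola_le_twice[of "gap x t"] gap_bounds[of x t] x that
    by (simp add: power2_eq_square)
  have low: "\<bar>LBINT t:{0<..?b}. ?f t\<bar> \<le> ?b"
  proof -
    \<comment> \<open>Rewriting the piece as a cut-off function on the whole half-line allows decay
      constant \<open>c = 0\<close>.\<close>
    have "(LBINT t:{0<..?b}. ?f t) = (LBINT t:{0<..}. indicator {..?b} t * ?f t)"
      unfolding set_lebesgue_integral_def
      by (intro Bochner_Integration.integral_cong) (auto simp: indicator_def)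
    also have "\<bar>\<dots>\<bar> \<le> 1 * ?b + 0 / (real 1 * ?b ^ 1)"
      by (rule integral_bounded_decay(2)) (use f1 b in auto)
    finally show ?thesis by simp
  qed
  have up: "\<bar>LBINT t:{x<..}. ?f t\<bar> \<le> 2"
  proof -
    have "(LBINT t:{x<..}. ?f t) = (LBINT t:{0<..}. indicator {x<..} t * ?f t)"
      unfolding set_lebesgue_integral_def using x
      by (intro Bochner_Integration.integral_cong) (auto simp: indicator_def)
    also have "\<bar>\<dots>\<bar> \<le> 0 * x + 2 * x / (real 1 * x ^ 1)"
      by (rule integral_bounded_decay(2)) (use f2 x in auto)
    finally show ?thesis using x by simp
  qed
  have "{0<..} = ({0<..?b} \<union> {?b<..x}) \<union> {x<..}" using b by auto
  then have "(LBINT t:{0<..}. ?f t) = (LBINT t:({0<..?b} \<union> {?b<..x}) \<union> {x<..}. ?f t)"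
    by (rule arg_cong)
  also have "\<dots> = (LBINT t:{0<..?b} \<union> {?b<..x}. ?f t) + (LBINT t:{x<..}. ?f t)"
    by (rule set_integral_Un; (rule set_integrable_subset[OF int])?) (use b x in \<open>auto intro: less_trans[OF b(1)]\<close>)
  also have "(LBINT t:{0<..?b} \<union> {?b<..x}. ?f t) = (LBINT t:{0<..?b}. ?f t) + (LBINT t:{?b<..x}. ?f t)"
    by (rule set_integral_Un; (rule set_integrable_subset[OF int])?) (use b x in \<open>auto intro: less_trans[OF b(1)]\<close>)
  finally show ?thesis using low up integral_middle_blocks[OF x int, of n] by linarith
qed

section \<open>Replacing the gap by \<open>x / t^2\<close>\<close>

lemma set_integrable_frac_parabola_inverse_square:
  "x > 0 \<Longrightarrow> set_integrable lborel {0<..} (\<lambda>t. frac_parabola (x / t\<^sup>2))"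
proof (rule integral_bounded_decay(1)[where a = 1 and m = 1 and M = 1 and c = "2 * x"])
  fix t :: real assume "x > 0" "1 < t"
  then show "\<bar>frac_parabola (x / t\<^sup>2)\<bar> \<le> 2 * x / t ^ Suc 1"
    using frac_parabola_le_twice[of "x / t\<^sup>2"] frac_parabola_nonneg[of "x / t\<^sup>2"]
    by (simp add: power2_eq_square)
qed (auto simp: frac_parabola_nonneg frac_parabola_le_1)

text \<open>The arguments differ by \<open>x / (t^2 * (t + 1)) \<le> x / t^3\<close>, so the
  Lipschitz bound gives cubic decay beyond \<open>a\<close>; below \<open>a\<close> the bound 1 is
  used. The choice \<open>a = x powr (1 / 3)\<close> makes the two contributions equal.\<close>

lemma integral_parabola_gap_minus_square:
  assumes x: "x > 0" and a: "a > 0"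
  shows "\<bar>LBINT t:{0<..}. frac_parabola (gap x t) - frac_parabola (x / t\<^sup>2)\<bar> \<le> a + x / a\<^sup>2"
proof -
  have "\<bar>LBINT t:{0<..}. frac_parabola (gap x t) - frac_parabola (x / t\<^sup>2)\<bar> \<le> 1 * a + 2 * x / (real 2 * a ^ 2)"
  proof (rule integral_bounded_decay(2))
    fix t :: real
    show "\<bar>frac_parabola (gap x t) - frac_parabola (x / t\<^sup>2)\<bar> \<le> 1"
      using frac_parabola_nonneg[of "gap x t"] frac_parabola_le_1[of "gap x t"]
        frac_parabola_nonneg[of "x / t\<^sup>2"] frac_parabola_le_1[of "x / t\<^sup>2"] by linarith
    assume "a < t"
    then have t: "t > 0" using a by simp
    have "x / t\<^sup>2 - gap x t = x / (t\<^sup>2 * (t + 1))"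
      unfolding gap_def using t by (simp add: divide_simps power2_eq_square) (simp add: algebra_simps)
    also have "\<dots> \<le> x / t ^ 3"
      using x t by (intro divide_left_mono) (auto simp: power2_eq_square power3_eq_cube intro!: mult_mono mult_pos_pos)
    finally have "\<bar>gap x t - x / t\<^sup>2\<bar> \<le> x / t ^ 3" using gap_bounds[OF x t] by simp
    then show "\<bar>frac_parabola (gap x t) - frac_parabola (x / t\<^sup>2)\<bar> \<le> 2 * x / t ^ Suc 2"
      using frac_parabola_lipschitz[of "gap x t" "x / t\<^sup>2"] by (simp add: numeral_eq_Suc)
  qed (use a in auto)
  then show ?thesis by simp
qed

section \<open>Bounds for \<open>T\<close> at large and at small \<open>x\<close>\<close>

lemma T_eq: "T x = (LBINT t:{0<..}. osc x t)"
  by (simp add: T_def osc_def)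

lemma T_approx_large:
  assumes x: "x \<ge> 1"
  shows "\<bar>T x - (LBINT t:{0<..}. frac_parabola (x / t\<^sup>2))\<bar> \<le> 37 * x powr (1 / 3)"
proof -
  define X where "X = x powr (1 / 3)"
  have X: "X \<ge> 1" unfolding X_def using x by (intro ge_one_powr_ge_zero) auto
  have X3: "x = X ^ 3" unfolding X_def using x by (simp add: powr_power)
  \<comment> \<open>Balances the trivial range against the blocks: with \<open>n\<close> close to
    \<open>X^2\<close>, both \<open>x / (n + 1)\<close> and \<open>sqrt n\<close> are at most
    \<open>X\<close>. The total 37 is \<open>1 + 32 + 2\<close> from the averaging plus 2 from
    replacing the gap.\<close>
  define n where "n = nat \<lfloor>X\<^sup>2\<rfloor>"
  have "real n \<le> X\<^sup>2" unfolding n_def by (rule of_nat_floor) simp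
  moreover have n1: "X\<^sup>2 \<le> real n + 1" unfolding n_def by linarith
  ultimately have sq: "sqrt (real n) \<le> X" using X by (intro real_le_lsqrt) auto
  have low: "x / (real n + 1) \<le> X"
  proof -
    have "x = X * X\<^sup>2" unfolding X3 by (simp add: power2_eq_square power3_eq_cube)
    also have "\<dots> \<le> X * (real n + 1)" using X n1 by (intro mult_left_mono) auto
    finally show ?thesis by (subst pos_divide_le_eq) auto
  qed
  have x0: "x > 0" using x by simp
  note i = set_integrable_osc[OF x0] set_integrable_frac_parabola_gap[OF x0]
    set_integrable_frac_parabola_inverse_square[OF x0]
  have sec: "\<bar>LBINT t:{0<..}. frac_parabola (gap x t) - frac_parabola (x / t\<^sup>2)\<bar> \<le> 2 * X"
    using integral_parabola_gap_minus_square[OF x0, of X] X X3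
    by (simp add: power2_eq_square power3_eq_cube)
  have "\<bar>LBINT t:{0<..}. osc x t - frac_parabola (gap x t)\<bar> \<le> 35 * X"
    using integral_osc_minus_parabola[OF x0, of n] sq low X by linarith
  then show ?thesis using sec
    unfolding set_integral_diff(2)[OF i(1,2)] set_integral_diff(2)[OF i(2,3)] T_eq X_def by linarith
qed

text \<open>For \<open>x \<le> 1\<close> no averaging is required. Since
  \<open>x \<le> sqrt x\<close>, the quadratic decay holds beyond \<open>sqrt x\<close>, and cutting
  there gives \<open>sqrt x\<close> from each side.\<close>

lemma T_bounds_small:
  assumes x: "0 < x" "x \<le> 1"
  shows "\<bar>T x\<bar> \<le> 2 * sqrt x"
proof -
  have "\<bar>LBINT t:{0<..}. osc x t\<bar> \<le> 1 * sqrt x + x / (real 1 * sqrt x ^ 1)"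
  proof (rule integral_bounded_decay(2))
    fix t assume t: "sqrt x < t"
    have "x \<le> sqrt x" using x by (intro real_le_rsqrt) (simp add: power2_eq_square mult_le_one mult_left_le)
    then show "\<bar>osc x t\<bar> \<le> x / t ^ Suc 1"
      using osc_tail[of x t] osc_bounds[of x t] x t by (simp add: power2_eq_square)
  qed (use osc_bounds[of x] x in auto)
  then show ?thesis using x by (simp add: T_eq real_div_sqrt)
qed

section \<open>Partial fractions of coth and the Laplace transform of \<open>{y} (1 - {y})\<close>\<close>

text \<open>Euler's product for the sine at the imaginary argument \<open>\<i> * y\<close>; the
  factor \<open>- \<i>\<close> turns \<open>\<i> * sinh\<close> into \<open>sinh\<close>.\<close>

lemma sinh_product_formula:
  fixes y :: real
  shows "(\<lambda>n. pi * y * (\<Prod>k=1..n. 1 + y\<^sup>2 / real k ^ 2)) \<longlonglongrightarrow> sinh (pi * y)"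
proof -
  have "(\<lambda>n. - \<i> * (of_real pi * (\<i> * of_real y) * (\<Prod>k=1..n. 1 - (\<i> * of_real y)^2 / of_nat k^2)))
      \<longlonglongrightarrow> - \<i> * sin (of_real pi * (\<i> * of_real y))"
    by (intro tendsto_mult_left sin_product_formula_complex)
  also have "(\<lambda>n. - \<i> * (of_real pi * (\<i> * of_real y) * (\<Prod>k=1..n. 1 - (\<i> * of_real y)^2 / of_nat k^2)))
      = (\<lambda>n. complex_of_real (pi * y * (\<Prod>k=1..n. 1 + y\<^sup>2 / real k ^ 2)))"
  proof -
    have "- \<i> * (p * (\<i> * w) * q) = p * w * q" for p w q :: complex by (simp add: algebra_simps)
    then show ?thesis by (simp add: power_mult_distrib)
  qed
  also have "- \<i> * sin (of_real pi * (\<i> * of_real y)) = complex_of_real (sinh (pi * y))"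
  proof -
    have *: "\<i> * (of_real pi * (\<i> * of_real y)) = - of_real (pi * y)" by (simp add: algebra_simps)
    show ?thesis unfolding sin_exp_eq *
      by (simp add: sinh_field_def exp_of_real[symmetric] field_simps)
  qed
  finally show ?thesis by (subst (asm) tendsto_of_real_iff)
qed

lemma ln_sinh_sums:
  fixes y :: real
  assumes y: "y > 0"
  shows "(\<lambda>n. ln (1 + y\<^sup>2 / real (Suc n) ^ 2)) sums ln (sinh (pi * y) / (pi * y))"
proof -
  have pos: "1 + y\<^sup>2 / real k ^ 2 > 0" for k by (simp add: add_pos_nonneg)
  have "(\<lambda>n. pi * y * (\<Prod>k=1..n. 1 + y\<^sup>2 / real k ^ 2) / (pi * y)) \<longlonglongrightarrow> sinh (pi * y) / (pi * y)"
    using y by (intro tendsto_divide sinh_product_formula tendsto_const) auto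
  then have "(\<lambda>n. \<Prod>k=1..n. 1 + y\<^sup>2 / real k ^ 2) \<longlonglongrightarrow> sinh (pi * y) / (pi * y)"
    using y by simp
  then have "(\<lambda>n. ln (\<Prod>k=1..n. 1 + y\<^sup>2 / real k ^ 2)) \<longlonglongrightarrow> ln (sinh (pi * y) / (pi * y))"
    using y by (intro tendsto_ln) auto
  also have "(\<lambda>n. ln (\<Prod>k=1..n. 1 + y\<^sup>2 / real k ^ 2)) = (\<lambda>n. \<Sum>k<n. ln (1 + y\<^sup>2 / real (Suc k) ^ 2))"
  proof
    fix n
    have "ln (\<Prod>k=1..n. 1 + y\<^sup>2 / real k ^ 2) = (\<Sum>k=1..n. ln (1 + y\<^sup>2 / real k ^ 2))"
      using pos by (intro ln_prod) (auto simp: add_nonneg_eq_0_iff)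
    also have "\<dots> = (\<Sum>k<n. ln (1 + y\<^sup>2 / real (Suc k) ^ 2))"
      by (rule sum.reindex_bij_witness[of _ Suc "\<lambda>k. k - 1"]) auto
    finally show "ln (\<Prod>k=1..n. 1 + y\<^sup>2 / real k ^ 2) = (\<Sum>k<n. ln (1 + y\<^sup>2 / real (Suc k) ^ 2))" .
  qed
  finally show ?thesis by (simp add: sums_def)
qed

text \<open>Logarithmic derivative of the product for \<open>sinh\<close>: the series of logarithms
  is differentiated term by term and compared with the derivative of its closed form.\<close>

lemma coth_partial_fractions:
  fixes y :: real
  assumes y: "y > 0"
  shows "(\<lambda>n. 2 * y / (real (Suc n) ^ 2 + y\<^sup>2)) sums (pi * cosh (pi * y) / sinh (pi * y) - 1 / y)"
proof -
  let ?f = "\<lambda>n y. ln (1 + y\<^sup>2 / real (Suc n) ^ 2)"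
  let ?f' = "\<lambda>n y. 2 * y / (real (Suc n) ^ 2 + y\<^sup>2)"
  \<comment> \<open>A bounded neighbourhood of \<open>y\<close>: there \<open>z < 2 * y\<close>
    makes the derivatives uniformly summable against inverse squares.\<close>
  define S where "S = {0<..<2 * y}"
  have deriv: "(?f n has_real_derivative ?f' n z) (at z within S)" for n z
  proof -
    define c where "c = real (Suc n) ^ 2"
    have c: "c > 0" by (simp add: c_def)
    then have pos: "1 + z\<^sup>2 * (1 / c) > 0" by (simp add: add_pos_nonneg)
    have "((\<lambda>z. ln (1 + z\<^sup>2 * (1 / c))) has_real_derivative (2 * z * (1 / c)) / (1 + z\<^sup>2 * (1 / c))) (at z within S)"
      using c pos by (auto intro!: derivative_eq_intros)
    also have "(2 * z * (1 / c)) / (1 + z\<^sup>2 * (1 / c)) = 2 * z / (c + z\<^sup>2)"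
      using c pos by (simp add: divide_simps)
    finally show ?thesis by (simp add: c_def)
  qed
  have M: "summable (\<lambda>n. 4 * y * (1 / real (Suc n) ^ 2))"
    using inverse_squares_sums by (intro summable_mult) (auto simp: sums_iff add.commute)
  have bound: "norm (?f' n z) \<le> 4 * y * (1 / real (Suc n) ^ 2)" if "z \<in> S" for n z
  proof -
    have "2 * z / (real (Suc n) ^ 2 + z\<^sup>2) \<le> 4 * y / real (Suc n) ^ 2"
      using that by (intro frac_le) (auto simp: S_def)
    then show ?thesis using that by (simp add: S_def)
  qed
  have unif: "uniformly_convergent_on S (\<lambda>n z. \<Sum>i<n. ?f' i z)"
    by (rule Weierstrass_m_test'[OF bound M])
  have yS: "y \<in> S" "open S" using y by (auto simp: S_def)
  have "((\<lambda>z. \<Sum>n. ?f n z) has_real_derivative (\<Sum>n. ?f' n y)) (at y)"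
  proof (rule has_field_derivative_series'(2)[OF _ deriv unif yS(1)])
    show "summable (\<lambda>n. ?f n y)" using ln_sinh_sums[OF y] by (rule sums_summable)
    show "y \<in> interior S" using yS by (simp add: interior_open)
  qed (simp add: S_def)
  moreover have "\<forall>\<^sub>F z in nhds y. (\<Sum>n. ?f n z) = ln (sinh (pi * z) / (pi * z))"
    using eventually_nhds_in_open[OF yS(2,1)]
    by eventually_elim (use ln_sinh_sums in \<open>auto simp: S_def sums_iff\<close>)
  ultimately have "((\<lambda>z. ln (sinh (pi * z) / (pi * z))) has_real_derivative (\<Sum>n. ?f' n y)) (at y)"
    by (subst (asm) DERIV_cong_ev[OF refl _ refl])
  moreover have "((\<lambda>z. ln (sinh (pi * z) / (pi * z))) has_real_derivative
      (pi * cosh (pi * y) / sinh (pi * y) - 1 / y)) (at y)"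
  proof -
    have s: "sinh (pi * y) > 0" using y by simp
    have "((\<lambda>z. ln (sinh (pi * z) / (pi * z))) has_real_derivative
      ((pi * cosh (pi * y)) * (pi * y) - sinh (pi * y) * pi) / ((pi * y) * (pi * y)) / (sinh (pi * y) / (pi * y))) (at y)"
      using y s by (auto intro!: derivative_eq_intros simp: field_simps)
    also have "((pi * cosh (pi * y)) * (pi * y) - sinh (pi * y) * pi) / ((pi * y) * (pi * y)) / (sinh (pi * y) / (pi * y))
       = pi * cosh (pi * y) / sinh (pi * y) - 1 / y"
      using y s by (simp add: divide_simps) (simp add: algebra_simps)
    finally show ?thesis .
  qed
  ultimately have "(\<Sum>n. ?f' n y) = pi * cosh (pi * y) / sinh (pi * y) - 1 / y"
    by (rule DERIV_unique)
  moreover have "summable (\<lambda>n. ?f' n y)"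
    by (rule summable_comparison_test'[OF M]) (use bound yS in auto)
  ultimately show ?thesis by (simp add: sums_iff)
qed

section \<open>The Laplace transform of \<open>frac y * (1 - frac y)\<close>\<close>

lemma set_integrable_frac_laplace:
  fixes s :: real
  assumes s: "s > 0"
  shows "set_integrable lborel {0<..} (\<lambda>y. frac y * (1 - frac y) * exp (- s * y))"
proof (rule integral_bounded_decay(1)[where a = 1 and m = 1 and M = 1 and c = "2 / s\<^sup>2"])
  have b: "0 \<le> frac y * (1 - frac y) \<and> frac y * (1 - frac y) \<le> 1" for y :: real
    using frac_parabola_nonneg[of y] frac_parabola_le_1[of y] by (simp add: frac_parabola_def)
  have le: "\<bar>frac y * (1 - frac y) * exp (- s * y)\<bar> \<le> exp (- s * y)" for y
    using b[of y] mult_right_mono[of "frac y * (1 - frac y)" 1 "exp (- s * y)"]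
    by (subst abs_of_nonneg) auto
  fix y :: real
  {
    assume "0 < y"
    then have "exp (- s * y) \<le> 1" using s by simp
    then show "\<bar>frac y * (1 - frac y) * exp (- s * y)\<bar> \<le> 1" using le[of y] by linarith
  }
  {
    assume y: "1 < y"
    have "0 < s * y" using s y by simp
    then have "(s * y)\<^sup>2 / 2 \<le> exp (s * y)"
      using exp_lower_Taylor_quadratic[of "s * y"] by linarith
    then have "exp (- s * y) \<le> 1 / ((s * y)\<^sup>2 / 2)"
      using s y divide_left_mono[of "(s * y)\<^sup>2 / 2" "exp (s * y)" 1]
      by (simp add: exp_minus inverse_eq_divide)
    also have "\<dots> = 2 / s\<^sup>2 / y ^ Suc 1" by (simp add: power_mult_distrib power2_eq_square)
    finally show "\<bar>frac y * (1 - frac y) * exp (- s * y)\<bar> \<le> 2 / s\<^sup>2 / y ^ Suc 1"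
      using le[of y] by linarith
  }
qed auto

text \<open>
  Shifting by one period gives \<open>L = A + exp (- s) L\<close> for the transform \<open>L\<close>, where \<open>A\<close> is the integral over \<open>[0, 1]\<close>.
\<close>

lemma frac_laplace:
  fixes s :: real
  assumes s: "s > 0"
  shows "(1 - exp (- s)) * (LBINT y:{0<..}. frac y * (1 - frac y) * exp (- s * y))
     = (1 + exp (- s)) / s\<^sup>2 - 2 * (1 - exp (- s)) / s ^ 3"
proof -
  define f where "f y = indicator {0<..} y * (frac y * (1 - frac y) * exp (- s * y))" for y
  define A where "A = (1 + exp (- s)) / s\<^sup>2 - 2 * (1 - exp (- s)) / s ^ 3"
  have int: "integrable lborel f"
    using set_integrable_frac_laplace[OF s] by (simp add: set_integrable_def f_def[abs_def])
  define g where "g v = indicator {0..1} v *\<^sub>R (v * (1 - v) * exp (- s * v))" for v :: real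
  \<comment> \<open>The quadratic solution of \<open>P' - s * P = v * (1 - v)\<close>, so that
    \<open>P v * exp (- s * v)\<close> is an antiderivative on the first period.\<close>
  define P where "P v = v\<^sup>2 / s + v * (2 / s\<^sup>2 - 1 / s) + (2 / s ^ 3 - 1 / s\<^sup>2)" for v
  have g: "has_bochner_integral lborel g (P 1 * exp (- s * 1) - P 0 * exp (- s * 0))"
    unfolding g_def
  proof (rule has_bochner_integral_FTC_Icc)
    fix v :: real
    have "((\<lambda>v. P v * exp (- s * v)) has_real_derivative
       (2 * v / s + (2 / s\<^sup>2 - 1 / s)) * exp (- s * v) + P v * (exp (- s * v) * (- s))) (at v within {0..1})"
      unfolding P_def using s by (auto intro!: derivative_eq_intros)
    also have "(2 * v / s + (2 / s\<^sup>2 - 1 / s)) * exp (- s * v) + P v * (exp (- s * v) * (- s))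
        = ((2 * v / s + (2 / s\<^sup>2 - 1 / s)) - s * P v) * exp (- s * v)"
      by (simp add: algebra_simps)
    also have "(2 * v / s + (2 / s\<^sup>2 - 1 / s)) - s * P v = v * (1 - v)"
      unfolding P_def using s by (simp add: field_simps power2_eq_square power3_eq_cube)
    finally show "((\<lambda>v. P v * exp (- s * v)) has_vector_derivative v * (1 - v) * exp (- s * v)) (at v within {0..1})"
      by (simp add: has_real_derivative_iff_has_vector_derivative)
  qed (auto intro!: continuous_intros)
  have A: "P 1 * exp (- s * 1) - P 0 * exp (- s * 0) = A"
    unfolding P_def A_def using s by (simp add: field_simps power2_eq_square power3_eq_cube)
  \<comment> \<open>\<open>f\<close> vanishes for \<open>y \<le> 0\<close> and \<open>g\<close>
    lives on \<open>[0, 1]\<close>, so the shifted copy supplies all later periods. At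
    \<open>y = 1\<close> every term is 0.\<close>
  have rec: "f y = g y + exp (- s) * f (- 1 + 1 * y)" for y
  proof -
    consider "y \<le> 0" | "0 < y" "y < 1" | "y = 1" | "y > 1" by linarith
    then show ?thesis
    proof cases
      case 2
      then have "frac y = y" by (simp add: frac_eq)
      then show ?thesis using 2 by (simp add: f_def g_def)
    next
      case 4
      have "frac (- 1 + y) = frac y" using frac_1_eq[of "y - 1"] by simp
      moreover have "exp (- s) * exp (- s * (- 1 + y)) = exp (- s * y)"
        by (simp add: exp_add[symmetric] algebra_simps)
      ultimately show ?thesis using 4 by (simp add: f_def g_def)
    qed (auto simp: f_def g_def)
  qed
  have shift: "integrable lborel (\<lambda>y. f (- 1 + 1 * y))" "(LBINT y. f (- 1 + 1 * y)) = (LBINT y. f y)"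
    using lborel_integrable_real_affine[OF int, of 1 "- 1"] lborel_integral_real_affine[of 1 f "- 1"] by auto
  have 1: "(LBINT y. f y) = (LBINT y. g y + exp (- s) * f (- 1 + 1 * y))"
    by (rule Bochner_Integration.integral_cong[OF refl rec])
  have 2: "(LBINT y. g y + exp (- s) * f (- 1 + 1 * y)) = (LBINT y. g y) + (LBINT y. exp (- s) * f (- 1 + 1 * y))"
    by (intro Bochner_Integration.integral_add integrable_mult_right shift(1) integrable.intros[OF g])
  have 3: "(LBINT y. g y) = A"
    using has_bochner_integral_integral_eq[OF g] A by (rule trans)
  have 4: "(LBINT y. exp (- s) * f (- 1 + 1 * y)) = exp (- s) * (LBINT y. f y)"
    unfolding integral_mult_right_zero shift(2) ..
  have "(LBINT y. f y) = A + exp (- s) * (LBINT y. f y)"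
    using 1 2[unfolded 3 4] by (rule trans)
  then have "(1 - exp (- s)) * (LBINT y. f y) = A" by (simp add: left_diff_distrib)
  then show ?thesis by (simp add: A_def f_def set_lebesgue_integral_def)
qed

text \<open>The transform is \<open>coth (s / 2) / s^2 - 2 / s^3\<close>. Taking
  \<open>y = s / (2 * pi)\<close> in the partial fractions makes their term \<open>1 / y\<close>
  match \<open>2 / s^3\<close>, so only positive summands remain.\<close>

lemma frac_laplace_sums:
  fixes s :: real
  assumes s: "s > 0"
  shows "(\<lambda>n. 4 / (s * (s\<^sup>2 + (2 * pi * real (Suc n))\<^sup>2))) sums
     (LBINT y:{0<..}. frac y * (1 - frac y) * exp (- s * y))"
proof -
  let ?L = "LBINT y:{0<..}. frac y * (1 - frac y) * exp (- s * y)"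
  define y where "y = s / (2 * pi)"
  define E where "E = exp (- s)"
  have y: "y > 0" "s = 2 * pi * y" using s by (auto simp: y_def)
  have E: "0 < E" "E < 1" using s by (auto simp: E_def)
  have coth: "cosh (pi * y) / sinh (pi * y) = (1 + E) / (1 - E)"
  proof -
    define e where "e = exp (pi * y)"
    have e: "e > 1" "E = 1 / (e * e)" unfolding e_def E_def using y
      by (auto simp: exp_add[symmetric] exp_minus inverse_eq_divide)
    define m where "m = e * e"
    have m: "m > 1" using e(1) by (metis less_1_mult m_def)
    have half: "(a / 2) / (b / 2) = a / b" for a b :: real by simp
    have "cosh (pi * y) / sinh (pi * y) = (e + 1 / e) / (e - 1 / e)"
      unfolding cosh_field_def sinh_field_def half by (simp add: e_def exp_minus inverse_eq_divide)
    also have "e + 1 / e = (m + 1) / e" using e(1) by (simp add: field_simps m_def)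
    also have "e - 1 / e = (m - 1) / e" using e(1) by (simp add: field_simps m_def)
    also have "(m + 1) / e / ((m - 1) / e) = (m + 1) / m / ((m - 1) / m)" using e(1) m by simp
    also have "(m + 1) / m = 1 + E" using m e(2) by (simp add: m_def[symmetric] add_divide_distrib)
    also have "(m - 1) / m = 1 - E" using m e(2) by (simp add: m_def[symmetric] diff_divide_distrib)
    finally show ?thesis .
  qed
  have "?L = ((1 + E) / s\<^sup>2 - 2 * (1 - E) / s ^ 3) / (1 - E)"
    using frac_laplace[OF s] E by (simp add: E_def eq_divide_eq mult.commute)
  also have "\<dots> = (1 / (pi * s\<^sup>2)) * (pi * ((1 + E) / (1 - E)) - 1 / y)"
  proof -
    define R where "R = (1 + E) / (1 - E)"
    have R: "1 + E = R * (1 - E)" using E by (simp add: R_def)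
    have "((1 + E) / s\<^sup>2 - 2 * (1 - E) / s ^ 3) / (1 - E) = R / s\<^sup>2 - 2 / s ^ 3"
    proof -
      have cancel: "(R * d / a - 2 * d / b) / d = R / a - 2 / b" if "d \<noteq> 0" for a b d :: real
        using that by (simp add: diff_divide_distrib)
      show ?thesis unfolding R by (rule cancel) (use E in simp)
    qed
    also have "\<dots> = (1 / (pi * s\<^sup>2)) * (pi * R - 1 / y)"
      unfolding y_def using s by (simp add: right_diff_distrib power2_eq_square power3_eq_cube)
    finally show ?thesis by (simp add: R_def)
  qed
  also have "\<dots> = (1 / (pi * s\<^sup>2)) * (pi * cosh (pi * y) / sinh (pi * y) - 1 / y)"
    by (simp add: coth[symmetric])
  finally have L: "?L = (1 / (pi * s\<^sup>2)) * (pi * cosh (pi * y) / sinh (pi * y) - 1 / y)" .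
  have "(\<lambda>n. (1 / (pi * s\<^sup>2)) * (2 * y / (real (Suc n) ^ 2 + y\<^sup>2))) sums ?L"
    unfolding L by (intro sums_mult coth_partial_fractions y)
  also have "(\<lambda>n. (1 / (pi * s\<^sup>2)) * (2 * y / (real (Suc n) ^ 2 + y\<^sup>2)))
      = (\<lambda>n. 4 / (s * (s\<^sup>2 + (2 * pi * real (Suc n))\<^sup>2)))"
  proof
    fix n
    define b where "b = real (Suc n)"
    have b: "b > 0" by (simp add: b_def)
    have nz: "b\<^sup>2 + y\<^sup>2 > 0" using b by (simp add: add_pos_nonneg)
    have "s\<^sup>2 + (2 * pi * b)\<^sup>2 = 4 * pi\<^sup>2 * (b\<^sup>2 + y\<^sup>2)" unfolding y(2) by (simp add: power2_eq_square algebra_simps)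
    then have "4 / (s * (s\<^sup>2 + (2 * pi * b)\<^sup>2)) = 4 / (2 * pi * y * (4 * pi\<^sup>2 * (b\<^sup>2 + y\<^sup>2)))" using y(2) by simp
    also have "\<dots> = (1 / (pi * s\<^sup>2)) * (2 * y / (b\<^sup>2 + y\<^sup>2))"
      unfolding y(2) using nz y(1) by (simp add: divide_simps power2_eq_square)
    finally show "(1 / (pi * s\<^sup>2)) * (2 * y / (real (Suc n) ^ 2 + y\<^sup>2)) = 4 / (s * (s\<^sup>2 + (2 * pi * real (Suc n))\<^sup>2))"
      by (simp add: b_def)
  qed
  finally show ?thesis .
qed

section \<open>The constant\<close>

text \<open>Over the reals \<open>q^4 + c^4\<close> factors as
  \<open>(q^2 + sqrt 2 * c * q + c^2) * (q^2 - sqrt 2 * c * q + c^2)\<close>. Partial fractions then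
  give the antiderivative \<open>F\<close>, which vanishes at 0.\<close>

lemma nn_integral_inverse_quartic:
  fixes c :: real
  assumes c: "c > 0"
  shows "(\<integral>\<^sup>+q. ennreal (1 / (q ^ 4 + c ^ 4)) * indicator {0..} q \<partial>lborel)
     = ennreal (pi / (2 * sqrt 2 * c ^ 3))"
proof -
  define r where "r = sqrt 2"
  have r: "r * r = 2" "r > 0" by (simp_all add: r_def)
  define F where "F q = (ln (q\<^sup>2 + r * c * q + c\<^sup>2) - ln (q\<^sup>2 - r * c * q + c\<^sup>2)) / (4 * r * c ^ 3)
     + (arctan (r * q / c + 1) + arctan (r * q / c - 1)) / (2 * r * c ^ 3)" for q
  have pos: "q\<^sup>2 + r * c * q + c\<^sup>2 > 0" "q\<^sup>2 - r * c * q + c\<^sup>2 > 0" for q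
  proof -
    have "q\<^sup>2 + r * c * q + c\<^sup>2 = (q + r * c / 2)\<^sup>2 + (c\<^sup>2 / 2)"
      "q\<^sup>2 - r * c * q + c\<^sup>2 = (q - r * c / 2)\<^sup>2 + (c\<^sup>2 / 2)"
      using r(1) by (simp_all add: power2_eq_square algebra_simps)
    then show "q\<^sup>2 + r * c * q + c\<^sup>2 > 0" "q\<^sup>2 - r * c * q + c\<^sup>2 > 0"
      using c by (auto intro!: add_nonneg_pos)
  qed
  have "(\<integral>\<^sup>+q. ennreal (1 / (q ^ 4 + c ^ 4)) * indicator {0..} q \<partial>lborel)
     = ennreal (pi / (2 * r * c ^ 3) - F 0)"
  proof (rule nn_integral_FTC_atLeast)
    fix q :: real
    show "0 \<le> 1 / (q ^ 4 + c ^ 4)" by simp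
    let ?A = "q\<^sup>2 + r * c * q + c\<^sup>2" and ?B = "q\<^sup>2 - r * c * q + c\<^sup>2"
    have sq: "1 + (r * q / c + 1)\<^sup>2 = 2 * ?A / c\<^sup>2" "1 + (r * q / c - 1)\<^sup>2 = 2 * ?B / c\<^sup>2"
      using c r(1) by (simp_all add: field_simps power2_eq_square)
    have "(F has_real_derivative ((2 * q + r * c) / ?A - (2 * q - r * c) / ?B) / (4 * r * c ^ 3)
      + (r / c / (1 + (r * q / c + 1)\<^sup>2) + r / c / (1 + (r * q / c - 1)\<^sup>2)) / (2 * r * c ^ 3)) (at q)"
    proof -
      have ln_deriv: "((\<lambda>q. ln (q\<^sup>2 + r * c * q + c\<^sup>2)) has_real_derivative (2 * q + r * c) / ?A) (at q)"
        "((\<lambda>q. ln (q\<^sup>2 - r * c * q + c\<^sup>2)) has_real_derivative (2 * q - r * c) / ?B) (at q)"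
        using pos[of q] by (auto intro!: derivative_eq_intros)
      have arctan_deriv: "((\<lambda>q. arctan (r * q / c + 1)) has_real_derivative r / c / (1 + (r * q / c + 1)\<^sup>2)) (at q)"
        "((\<lambda>q. arctan (r * q / c - 1)) has_real_derivative r / c / (1 + (r * q / c - 1)\<^sup>2)) (at q)"
        using c by (auto intro!: derivative_eq_intros simp: inverse_eq_divide)
      show ?thesis unfolding F_def[abs_def]
        by (intro DERIV_add DERIV_diff DERIV_cdivide ln_deriv arctan_deriv)
    qed
    also have "((2 * q + r * c) / ?A - (2 * q - r * c) / ?B) / (4 * r * c ^ 3)
      + (r / c / (1 + (r * q / c + 1)\<^sup>2) + r / c / (1 + (r * q / c - 1)\<^sup>2)) / (2 * r * c ^ 3)
      = 1 / (q ^ 4 + c ^ 4)"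
    proof -
      have "?A * ?B = q ^ 4 + 2 * (c\<^sup>2 * q\<^sup>2) + c ^ 4 - (r * r) * (c\<^sup>2 * q\<^sup>2)" by algebra
      then have AB: "?A * ?B = q ^ 4 + c ^ 4" unfolding r(1) by simp
      have "r / c / (2 * ?A / c\<^sup>2) = (r * c / 2) / ?A" "r / c / (2 * ?B / c\<^sup>2) = (r * c / 2) / ?B"
        using c by (simp_all add: power2_eq_square)
      note arctan_terms = this
      have combine: "((2 * q + k) / a - (2 * q - k) / b) / (2 * m) + (k / 2 / a + k / 2 / b) / m
          = ((2 * q + 2 * k) / a - (2 * q - 2 * k) / b) / (2 * m)" for a b k m :: real
        by (simp add: add_divide_distrib diff_divide_distrib)
      have "((2 * q + r * c) / ?A - (2 * q - r * c) / ?B) / (4 * r * c ^ 3)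
        + (r / c / (1 + (r * q / c + 1)\<^sup>2) + r / c / (1 + (r * q / c - 1)\<^sup>2)) / (2 * r * c ^ 3)
        = ((2 * q + 2 * (r * c)) / ?A - (2 * q - 2 * (r * c)) / ?B) / (4 * r * c ^ 3)"
        using combine[of "r * c" ?A ?B "2 * r * c ^ 3"] unfolding sq arctan_terms by (simp only: mult.assoc)
      also have "(2 * q + 2 * (r * c)) / ?A - (2 * q - 2 * (r * c)) / ?B
        = ((2 * q + 2 * (r * c)) * ?B - (2 * q - 2 * (r * c)) * ?A) / (?A * ?B)"
        using pos[of q] by (subst diff_frac_eq) (simp_all add: mult.commute)
      also have "(2 * q + 2 * (r * c)) * ?B - (2 * q - 2 * (r * c)) * ?A = 4 * r * c ^ 3"
        by algebra
      finally show ?thesis using c r(2) AB by simp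
    qed
    finally show "DERIV F q :> 1 / (q ^ 4 + c ^ 4)" .
  next
    \<comment> \<open>Each logarithm diverges on its own, so they are merged into one quotient
      tending to 1.\<close>
    have lnlim: "((\<lambda>q. ln ((q\<^sup>2 + r * c * q + c\<^sup>2) / (q\<^sup>2 - r * c * q + c\<^sup>2))) \<longlongrightarrow> ln 1) at_top"
    proof (rule tendsto_ln)
      show "((\<lambda>q. (q\<^sup>2 + r * c * q + c\<^sup>2) / (q\<^sup>2 - r * c * q + c\<^sup>2)) \<longlongrightarrow> 1) at_top"
        by real_asymp
    qed simp
    have at: "filterlim (\<lambda>q. r * q / c + 1) at_top at_top" "filterlim (\<lambda>q. r * q / c - 1) at_top at_top"
      using c r(2) by real_asymp+
    have "((\<lambda>q. ln ((q\<^sup>2 + r * c * q + c\<^sup>2) / (q\<^sup>2 - r * c * q + c\<^sup>2)) / (4 * r * c ^ 3)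
      + (arctan (r * q / c + 1) + arctan (r * q / c - 1)) / (2 * r * c ^ 3)) \<longlongrightarrow>
       ln 1 / (4 * r * c ^ 3) + (pi / 2 + pi / 2) / (2 * r * c ^ 3)) at_top"
      using c r(2)
      by (intro tendsto_add tendsto_divide tendsto_const lnlim
            filterlim_compose[OF tendsto_arctan_at_top at(1)] filterlim_compose[OF tendsto_arctan_at_top at(2)]) auto
    moreover have "ln ((q\<^sup>2 + r * c * q + c\<^sup>2) / (q\<^sup>2 - r * c * q + c\<^sup>2))
       = ln (q\<^sup>2 + r * c * q + c\<^sup>2) - ln (q\<^sup>2 - r * c * q + c\<^sup>2)" for q
      using pos[of q] by (rule ln_divide_pos)
    ultimately show "(F \<longlongrightarrow> pi / (2 * r * c ^ 3)) at_top"
      unfolding F_def[abs_def] by simp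
  qed measurable
  also have "F 0 = 0" by (simp add: F_def arctan_minus)
  finally show ?thesis by (simp add: r_def)
qed

text \<open>Scaling by \<open>sqrt y\<close> in the half-line Gaussian second moment
  \<open>sqrt pi / 4\<close> represents \<open>1 / (y * sqrt y)\<close> as a superposition of
  exponentials in \<open>y\<close>.\<close>

lemma nn_integral_gauss_second_moment:
  fixes y :: real
  assumes y: "y > 0"
  shows "(\<integral>\<^sup>+q. ennreal (indicator {0<..} q * (q\<^sup>2 * exp (- q\<^sup>2 * y))) \<partial>lborel)
     = ennreal (sqrt pi / 4 / (y * sqrt y))"
proof -
  define f where "f q = ennreal (indicator {0..} q *\<^sub>R (exp (- q\<^sup>2) * q ^ (2 * 1)))" for q :: real
  have [measurable]: "f \<in> borel_measurable borel" unfolding f_def by measurable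
  have "(\<integral>\<^sup>+q. f q \<partial>lborel) = ennreal (sqrt pi / 4)"
    unfolding f_def using gaussian_moment_even_pos[of 1]
    by (subst nn_integral_eq_integral) (auto simp: has_bochner_integral_iff indicator_def fact_numeral)
  moreover have "(\<integral>\<^sup>+q. f q \<partial>lborel) = ennreal (sqrt y) * (\<integral>\<^sup>+q. f (sqrt y * q) \<partial>lborel)"
    using y by (subst nn_integral_real_affine[where c = "sqrt y" and t = 0]) auto
  moreover have "f (sqrt y * q) = ennreal y * ennreal (indicator {0<..} q * (q\<^sup>2 * exp (- q\<^sup>2 * y)))" for q
    using y unfolding f_def
    by (subst ennreal_mult[symmetric])
       (auto simp: indicator_def zero_le_mult_iff power_mult_distrib mult_ac intro!: arg_cong[where f = ennreal])
  moreover have "(\<integral>\<^sup>+q. ennreal y * ennreal (indicator {0<..} q * (q\<^sup>2 * exp (- q\<^sup>2 * y))) \<partial>lborel)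
      = ennreal y * (\<integral>\<^sup>+q. ennreal (indicator {0<..} q * (q\<^sup>2 * exp (- q\<^sup>2 * y))) \<partial>lborel)"
    by (rule nn_integral_cmult) measurable
  ultimately have eq: "ennreal (sqrt pi / 4) = ennreal (y * sqrt y) * (\<integral>\<^sup>+q. ennreal (indicator {0<..} q * (q\<^sup>2 * exp (- q\<^sup>2 * y))) \<partial>lborel)"
    using y by (simp add: ennreal_mult mult_ac)
  have "ennreal (1 / (y * sqrt y)) * ennreal (sqrt pi / 4)
      = ennreal (1 / (y * sqrt y) * (y * sqrt y)) * (\<integral>\<^sup>+q. ennreal (indicator {0<..} q * (q\<^sup>2 * exp (- q\<^sup>2 * y))) \<partial>lborel)"
    unfolding eq using y by (subst ennreal_mult[of "1 / (y * sqrt y)" "y * sqrt y"]) (auto simp: mult.assoc)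
  then show ?thesis using y by (simp add: ennreal_mult[symmetric] mult.commute)
qed

text \<open>
  Writing \<open>1 / (y sqrt y)\<close> as a multiple of \<open>\<integral> q\<^sup>2 exp (- q\<^sup>2 y) dq\<close> and exchanging the integrals reduces the
  constant to the Laplace transform at \<open>q\<^sup>2\<close>, whose partial fractions contribute one term of the zeta series each.
\<close>

lemma nn_integral_frac_weighted:
  "(\<integral>\<^sup>+y. ennreal (indicator {0<..} y * (frac y * (1 - frac y) / (y * sqrt y))) \<partial>lborel)
     = ennreal (2 / pi * zeta_real (3 / 2))"
proof -
  define \<phi> :: "real \<Rightarrow> real" where "\<phi> y = frac y * (1 - frac y)" for y
  define K :: "real \<Rightarrow> real \<Rightarrow> real" where
    "K y q = indicator {0<..} y * indicator {0<..} q * (\<phi> y * (q\<^sup>2 * exp (- q\<^sup>2 * y)))" for y q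
  define W where "W = (\<integral>\<^sup>+y. ennreal (indicator {0<..} y * (\<phi> y / (y * sqrt y))) \<partial>lborel)"
  \<comment> \<open>Chosen so that at \<open>s = q^2\<close> the denominator
    \<open>s^2 + (2 * pi * (n + 1))^2\<close> becomes \<open>q^4 + b n ^ 4\<close>.\<close>
  define b where "b n = sqrt (2 * pi * real (Suc n))" for n
  have b: "b n > 0" "b n ^ 4 = (2 * pi * real (Suc n))\<^sup>2" for n
  proof -
    have "b n ^ 4 = ((b n)\<^sup>2)\<^sup>2" by (simp add: power_mult[symmetric])
    then show "b n ^ 4 = (2 * pi * real (Suc n))\<^sup>2" unfolding b_def by (subst (asm) real_sqrt_pow2) auto
  qed (simp add: b_def)
  have \<phi>: "0 \<le> \<phi> y" for y using frac_parabola_nonneg[of y] by (simp add: \<phi>_def frac_parabola_def)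
  have [measurable]: "\<phi> \<in> borel_measurable borel" unfolding \<phi>_def by measurable
  have inner_q: "(\<integral>\<^sup>+q. ennreal (K y q) \<partial>lborel)
      = ennreal (sqrt pi / 4) * ennreal (indicator {0<..} y * (\<phi> y / (y * sqrt y)))" for y
  proof (cases "y > 0")
    case True
    have "(\<integral>\<^sup>+q. ennreal (K y q) \<partial>lborel)
        = (\<integral>\<^sup>+q. ennreal (\<phi> y) * ennreal (indicator {0<..} q * (q\<^sup>2 * exp (- q\<^sup>2 * y))) \<partial>lborel)"
      using True \<phi>[of y] by (intro nn_integral_cong) (auto simp: K_def ennreal_mult[symmetric] indicator_def)
    also have "\<dots> = ennreal (\<phi> y) * ennreal (sqrt pi / 4 / (y * sqrt y))"
      by (subst nn_integral_cmult) (simp_all only: nn_integral_gauss_second_moment[OF True], measurable)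
    finally show ?thesis using True \<phi>[of y] by (simp add: ennreal_mult[symmetric] mult.commute)
  qed (simp add: K_def)
  \<comment> \<open>At \<open>q = 0\<close> the kernel vanishes while the series, with its closed
    indicator, does not; this null point is discarded by an almost-everywhere argument
    below.\<close>
  have inner_y: "(\<integral>\<^sup>+y. ennreal (K y q) \<partial>lborel)
      = (\<Sum>n. 4 * (ennreal (1 / (q ^ 4 + b n ^ 4)) * indicator {0..} q))" if "q \<noteq> 0" for q
  proof (cases "q > 0")
    case True
    define s where "s = q\<^sup>2"
    have s: "s > 0" using True by (simp add: s_def)
    let ?L = "LBINT y:{0<..}. frac y * (1 - frac y) * exp (- s * y)"
    have "(\<integral>\<^sup>+y. ennreal (K y q) \<partial>lborel)
        = (\<integral>\<^sup>+y. ennreal s * ennreal (indicator {0<..} y * (\<phi> y * exp (- s * y))) \<partial>lborel)"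
      using True \<phi> s
      by (intro nn_integral_cong) (auto simp: K_def s_def ennreal_mult[symmetric] indicator_def mult_ac)
    also have "\<dots> = ennreal s * (\<integral>\<^sup>+y. ennreal (indicator {0<..} y * (\<phi> y * exp (- s * y))) \<partial>lborel)"
      by (rule nn_integral_cmult) measurable
    also have "(\<integral>\<^sup>+y. ennreal (indicator {0<..} y * (\<phi> y * exp (- s * y))) \<partial>lborel) = ennreal ?L"
      using set_integrable_frac_laplace[OF s] \<phi>
      by (subst nn_integral_eq_integral)
         (auto simp: set_integrable_def set_lebesgue_integral_def \<phi>_def[symmetric] indicator_def)
    also have "ennreal s * ennreal ?L = ennreal (s * ?L)"
      using s by (simp add: ennreal_mult')
    also have "s * ?L = (\<Sum>n. 4 * (1 / (q ^ 4 + b n ^ 4)))"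
    proof -
      have "(\<lambda>n. s * (4 / (s * (s\<^sup>2 + (2 * pi * real (Suc n))\<^sup>2)))) sums (s * ?L)"
        by (intro sums_mult frac_laplace_sums s)
      moreover have "s\<^sup>2 = q ^ 4" by (simp add: s_def power_mult[symmetric])
      ultimately show ?thesis using s by (simp add: sums_iff b(2))
    qed
    also have "ennreal \<dots> = (\<Sum>n. ennreal (4 * (1 / (q ^ 4 + b n ^ 4))))"
    proof (rule suminf_ennreal2[symmetric])
      have "(\<lambda>n. s * (4 / (s * (s\<^sup>2 + (2 * pi * real (Suc n))\<^sup>2)))) sums (s * ?L)"
        by (intro sums_mult frac_laplace_sums s)
      moreover have "s\<^sup>2 = q ^ 4" by (simp add: s_def power_mult[symmetric])
      ultimately show "summable (\<lambda>n. 4 * (1 / (q ^ 4 + b n ^ 4)))" using s by (simp add: sums_iff b(2))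
    qed simp
    also have "\<dots> = (\<Sum>n. 4 * (ennreal (1 / (q ^ 4 + b n ^ 4)) * indicator {0..} q))"
      using True by (subst ennreal_mult) auto
    finally show ?thesis .
  qed (use that in \<open>simp add: K_def\<close>)
  have "ennreal (sqrt pi / 4) * W = (\<integral>\<^sup>+y. \<integral>\<^sup>+q. ennreal (K y q) \<partial>lborel \<partial>lborel)"
    unfolding inner_q W_def by (rule nn_integral_cmult[symmetric]) measurable
  also have "\<dots> = (\<integral>\<^sup>+q. \<integral>\<^sup>+y. ennreal (K y q) \<partial>lborel \<partial>lborel)"
    unfolding K_def by (rule lborel_pair.Fubini') measurable
  also have "\<dots> = (\<integral>\<^sup>+q. (\<Sum>n. 4 * (ennreal (1 / (q ^ 4 + b n ^ 4)) * indicator {0..} q)) \<partial>lborel)"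
    by (rule nn_integral_cong_AE, rule AE_mp[OF AE_lborel_singleton[of 0]]) (use inner_y in auto)
  also have "\<dots> = (\<Sum>n. \<integral>\<^sup>+q. 4 * (ennreal (1 / (q ^ 4 + b n ^ 4)) * indicator {0..} q) \<partial>lborel)"
    by (rule nn_integral_suminf) measurable
  also have "\<dots> = (\<Sum>n. ennreal (1 / (2 * sqrt pi) * (1 / real (Suc n) powr (3 / 2))))"
  proof (rule suminf_cong)
    fix n
    have "(\<integral>\<^sup>+q. 4 * (ennreal (1 / (q ^ 4 + b n ^ 4)) * indicator {0..} q) \<partial>lborel)
        = 4 * ennreal (pi / (2 * sqrt 2 * b n ^ 3))"
      by (subst nn_integral_cmult) (auto simp: nn_integral_inverse_quartic[OF b(1)])
    also have "\<dots> = ennreal (4 * (pi / (2 * sqrt 2 * b n ^ 3)))"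
      using b(1)[of n] by (subst ennreal_mult) auto
    \<comment> \<open>Here \<open>b n ^ 3 = (2 * pi * N) powr (3 / 2)\<close>, the source of the
      exponent 3/2 in the zeta series.\<close>
    also have "4 * (pi / (2 * sqrt 2 * b n ^ 3)) = 1 / (2 * sqrt pi) * (1 / real (Suc n) powr (3 / 2))"
    proof -
      define N where "N = real (Suc n)"
      have N: "N > 0" by (simp add: N_def)
      have "N powr (3 / 2) = N powr (1 + 1 / 2)" by simp
      also have "\<dots> = N * sqrt N" using N by (simp only: powr_add powr_half_sqrt) simp
      finally have p: "N powr (3 / 2) = N * sqrt N" .
      have "b n * b n = 2 * pi * N" by (simp add: b_def N_def)
      moreover have "b n = sqrt 2 * sqrt pi * sqrt N" unfolding b_def N_def real_sqrt_mult ..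
      ultimately have "b n ^ 3 = (2 * pi * N) * (sqrt 2 * sqrt pi * sqrt N)"
        unfolding power3_eq_cube by simp
      then have "2 * sqrt 2 * b n ^ 3 = (sqrt 2 * sqrt 2) * 4 * pi * sqrt pi * (N * sqrt N)"
        by (simp only: mult_ac)
      also have "\<dots> = 8 * pi * sqrt pi * (N * sqrt N)" by simp
      finally show ?thesis unfolding N_def[symmetric] p using N by (simp add: divide_simps)
    qed
    finally show "(\<integral>\<^sup>+q. 4 * (ennreal (1 / (q ^ 4 + b n ^ 4)) * indicator {0..} q) \<partial>lborel)
       = ennreal (1 / (2 * sqrt pi) * (1 / real (Suc n) powr (3 / 2)))" .
  qed
  also have "\<dots> = ennreal (\<Sum>n. 1 / (2 * sqrt pi) * (1 / real (Suc n) powr (3 / 2)))"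
    by (rule suminf_ennreal2, simp, intro summable_mult summable_zeta_real) simp
  also have "(\<Sum>n. 1 / (2 * sqrt pi) * (1 / real (Suc n) powr (3 / 2))) = 1 / (2 * sqrt pi) * zeta_real (3 / 2)"
    unfolding zeta_real_def by (intro suminf_mult summable_zeta_real) simp
  finally have eq: "ennreal (sqrt pi / 4) * W = ennreal (1 / (2 * sqrt pi) * zeta_real (3 / 2))" .
  have "W = ennreal (4 / sqrt pi * (sqrt pi / 4)) * W" by simp
  also have "\<dots> = ennreal (4 / sqrt pi) * (ennreal (sqrt pi / 4) * W)"
    by (subst ennreal_mult) (auto simp: mult.assoc)
  also have "\<dots> = ennreal (4 / sqrt pi * (1 / (2 * sqrt pi) * zeta_real (3 / 2)))"
    unfolding eq by (subst ennreal_mult') auto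
  also have "4 / sqrt pi * (1 / (2 * sqrt pi) * zeta_real (3 / 2)) = 2 / pi * zeta_real (3 / 2)"
    by (simp add: field_simps)
  finally show ?thesis by (simp add: W_def \<phi>_def)
qed

text \<open>Substituting \<open>t = sqrt (x / y)\<close> gives the Jacobian
  \<open>sqrt x / (2 * y * sqrt y)\<close>, whose factor 2 cancels the one in
  \<open>frac_parabola\<close>.\<close>

lemma integral_frac_parabola_inverse_square:
  assumes x: "x > 0"
  shows "(LBINT t:{0<..}. frac_parabola (x / t\<^sup>2)) = 2 / pi * zeta_real (3 / 2) * sqrt x"
proof -
  define w where "w y = frac y * (1 - frac y) / (y * sqrt y)" for y :: real
  have w: "0 \<le> indicator {0<..} y * w y" for y
    using frac_parabola_nonneg[of y] by (simp add: w_def frac_parabola_def indicator_def)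
  have [measurable]: "w \<in> borel_measurable borel" unfolding w_def by measurable
  have zeta: "0 \<le> zeta_real (3 / 2)" unfolding zeta_real_def by (intro suminf_nonneg summable_zeta_real) auto
  have "has_bochner_integral lborel (\<lambda>y. indicator {0<..} y * w y) (2 / pi * zeta_real (3 / 2))"
    using nn_integral_frac_weighted w zeta
    by (intro has_bochner_integral_nn_integral) (auto simp: w_def)
  then have "has_bochner_integral lborel (\<lambda>y. sqrt x * (indicator {0<..} y * w y)) (sqrt x * (2 / pi * zeta_real (3 / 2)))"
    by (rule has_bochner_integral_mult_right)
  then have int: "set_integrable lborel {0<..} (\<lambda>y. sqrt x * w y)"
    and val: "(LBINT y:{0<..}. sqrt x * w y) = sqrt x * (2 / pi * zeta_real (3 / 2))"
    by (auto simp: has_bochner_integral_iff set_integrable_def set_lebesgue_integral_def mult_ac)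
  define g where "g y = sqrt x / sqrt y" for y
  define g' where "g' y = - (sqrt x / (2 * (y * sqrt y)))" for y
  have g: "(g has_field_derivative g' y) (at y within {0<..})" if "y \<in> {0<..}" for y
    unfolding g_def[abs_def] g'_def using that
    by (auto intro!: derivative_eq_intros simp: divide_simps)
  have inj: "inj_on g {0<..}" using x by (auto simp: inj_on_def g_def)
  have img: "g ` {0<..} = {0<..}"
  proof (intro equalityI subsetI)
    fix t :: real assume "t \<in> {0<..}"
    then have t: "t > 0" by simp
    have "g (x / t\<^sup>2) = t" using x t by (simp add: g_def real_sqrt_divide)
    moreover have "x / t\<^sup>2 \<in> {0<..}" using x t by simp
    ultimately show "t \<in> g ` {0<..}" by (metis imageI)
  qed (use x in \<open>auto simp: g_def\<close>)
  have point: "\<bar>g' y\<bar> * frac_parabola (x / (g y)\<^sup>2) = sqrt x * w y" if "y \<in> {0<..}" for y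
  proof -
    have "x / (g y)\<^sup>2 = y" using x that by (simp add: g_def power_divide)
    then show ?thesis using x that by (simp add: g'_def frac_parabola_def w_def abs_mult)
  qed
  \<comment> \<open>The change of variables is phrased with \<open>absolutely_integrable_on\<close>
    and the gauge integral, so integrability and value are transferred to that setting
    first.\<close>
  have "(\<lambda>y. \<bar>g' y\<bar> * frac_parabola (x / (g y)\<^sup>2)) absolutely_integrable_on {0<..} \<and>
     integral {0<..} (\<lambda>y. \<bar>g' y\<bar> * frac_parabola (x / (g y)\<^sup>2)) = sqrt x * (2 / pi * zeta_real (3 / 2))"
  proof -
    have "(\<lambda>y. sqrt x * w y) absolutely_integrable_on {0<..}"
      using absolutely_integrable_on_def int by (auto simp: set_integrable_def intro!: integrable_completion[THEN iffD2])
    moreover have "integral {0<..} (\<lambda>y. sqrt x * w y) = sqrt x * (2 / pi * zeta_real (3 / 2))"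
      by (rule trans[OF set_borel_integral_eq_integral(2)[OF int, symmetric] val])
    moreover have "(\<lambda>y. \<bar>g' y\<bar> * frac_parabola (x / (g y)\<^sup>2)) absolutely_integrable_on {0<..} \<longleftrightarrow>
        (\<lambda>y. sqrt x * w y) absolutely_integrable_on {0<..}"
      by (rule set_integrable_cong[OF refl refl point])
    moreover have "integral {0<..} (\<lambda>y. \<bar>g' y\<bar> * frac_parabola (x / (g y)\<^sup>2)) = integral {0<..} (\<lambda>y. sqrt x * w y)"
      by (rule Henstock_Kurzweil_Integration.integral_cong[OF point])
    ultimately show ?thesis by (simp only: simp_thms)
  qed
  then have "integral {0<..} (\<lambda>t. frac_parabola (x / t\<^sup>2)) = sqrt x * (2 / pi * zeta_real (3 / 2))"
    using has_absolute_integral_change_of_variables_1'[OF _ g inj, where f = "\<lambda>t. frac_parabola (x / t\<^sup>2)"]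
    unfolding img by auto
  then show ?thesis
    using set_borel_integral_eq_integral(2)[OF set_integrable_frac_parabola_inverse_square[OF x]] by simp
qed

section \<open>Combining the ranges \<open>x \<ge> 1\<close> and \<open>x < 1\<close>\<close>

theorem theorem1:
  "\<exists>C>0. \<forall>x>0. \<bar>T x - 2 / pi * zeta_real (3 / 2) * sqrt x\<bar> \<le> C * x powr (13 / 30)"
proof -
  define Z where "Z = 2 / pi * zeta_real (3 / 2)"
  have Z: "Z \<ge> 0" unfolding Z_def zeta_real_def
    by (intro mult_nonneg_nonneg suminf_nonneg summable_zeta_real) auto
  have "\<bar>T x - Z * sqrt x\<bar> \<le> (37 + Z) * x powr (13 / 30)" if x: "x > 0" for x
  proof (cases "x \<ge> 1")
    case True
    have "\<bar>T x - Z * sqrt x\<bar> \<le> 37 * x powr (1 / 3)"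
      using T_approx_large[OF True] integral_frac_parabola_inverse_square[OF x] by (simp add: Z_def)
    \<comment> \<open>For \<open>x \<ge> 1\<close> powers increase with the exponent, and 1/3 is
      below 13/30.\<close>
    also have "\<dots> \<le> 37 * x powr (13 / 30)" using True by (intro mult_left_mono powr_mono) auto
    also have "\<dots> \<le> (37 + Z) * x powr (13 / 30)" using Z by (intro mult_right_mono) auto
    finally show ?thesis .
  next
    case False
    then have le: "x \<le> 1" by simp
    have "\<bar>T x - Z * sqrt x\<bar> \<le> \<bar>T x\<bar> + Z * sqrt x"
      using abs_triangle_ineq4[of "T x" "Z * sqrt x"] Z x by (simp add: abs_mult)
    also have "\<dots> \<le> 2 * sqrt x + Z * sqrt x" using T_bounds_small[OF x le] by simp
    also have "\<dots> = (2 + Z) * x powr (1 / 2)" using x by (simp add: powr_half_sqrt algebra_simps)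
    \<comment> \<open>For \<open>x \<le> 1\<close> the order reverses: 1/2 exceeds 13/30, so
      \<open>T x\<close> and the main term are separately small enough.\<close>
    also have "\<dots> \<le> (37 + Z) * x powr (13 / 30)"
      using Z x le by (intro mult_mono powr_mono') auto
    finally show ?thesis .
  qed
  then show ?thesis using Z unfolding Z_def by (intro exI[of _ "37 + 2 / pi * zeta_real (3 / 2)"]) auto
qed

end
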